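(* Let $R(z)\in\mathbb{C}(z)^{m\times m}$ be a para-Hermitian rational matrix, written (uniquely) as $$R(z)=R_{in}(z)+R_{out}(z)+R_{S^1}(z)+R_0,$$ where $R_{in}(z)$ is strictly proper with all its poles in the open unit disk, $R_{out}(z)$ satisfies $R_{out}(0)=0$ and has all its poles (infinity included) strictly outside the unit circle, $R_{S^1}(z)$ is strictly proper with all its poles on the unit circle, and $R_0$ is constant; put $R_p(z):=R_{S^1}(z)+R_0$. Let $R_{in}(z)=B(zA_1-A_0)^{-1}C$ be a minimal generalized state-space realization of $R_{in}(z)$ with $A_1$ invertible, and consider the corresponding strongly minimal $*$-palindromic linearization of $(1+z)[R_{in}(z)+R_{out}(z)]$ $$L_{in/out}(z):=\left[\begin{array}{cc|c}0&A_0-zA_1&C\\ zA_0^*-A_1^*&0&B^*(1+z)\\ \hline zC^*&B(1+z)&0\end{array}\right].$$ Let $$L_p(z):=\begin{bmatrix}-A_p(z)&B_p(z)\\ C_p(z)&D_p(z)\end{bmatrix}$$ be a strongly minimal $*$-palindromic linearization of $(1+z)R_p(z)$. Then the following pencil is a strongly minimal $*$-palindromic linearization of $(1+z)R(z)$: $$L(z):=\left[\begin{array}{ccc|c}0&A_0-zA_1&0&C\\ zA_0^*-A_1^*&0&0&B^*(1+z)\\ 0&0&-A_p(z)&B_p(z)\\ \hline zC^*&B(1+z)&C_p(z)&D_p(z)\end{array}\right].$$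
   Context: For a rational matrix $R(t)$ with complex coefficients, $R^*(t):=[R(\overline{t})]^*$ (the coefficients are conjugate-transposed, the variable is not conjugated). A square rational matrix $R(z)$ is para-Hermitian if $R^*(z)=R(1/z)$. For constant matrices $^*$ is the conjugate transpose. Strictly proper means tending to $0$ as $z\to\infty$. A pencil is a polynomial matrix of the form $L(z)=zL_1+L_0$. With $\mathrm{rev}_1 H(z):=zH(1/z)$, a square pencil $L(z)$ is $*$-palindromic if $\mathrm{rev}_1L^*(z)=L(z)$. A linear system matrix is a block-partitioned complex pencil $$L(z)=\begin{bmatrix}-A(z)&B(z)\\ C(z)&D(z)\end{bmatrix}=\begin{bmatrix}-zA_1+A_0& zB_1-B_0\\ zC_1-C_0& zD_1-D_0\end{bmatrix}$$ with $A(z)$ a square regular pencil ($\det A(z)\not\equiv0$; possibly of size $0$). Its transfer function is $D(z)+C(z)A(z)^{-1}B(z)$. It is minimal if $\begin{bmatrix}-A(z_0)&B(z_0)\end{bmatrix}$ has full row rank and $\begin{bmatrix}-A(z_0)\\ C(z_0)\end{bmatrix}$ has full column rank for all $z_0\in\mathbb{C}$; minimal at $\infty$ if $\begin{bmatrix}-A_1&B_1\end{bmatrix}$ has full row rank and $\begin{bmatrix}-A_1\\ C_1\end{bmatrix}$ has full column rank; strongly minimal if both hold. A strongly minimal linearization of $H(z)$ is a strongly minimal linear system matrix with transfer function $H(z)$. In the pencils of the claim the partition lines indicate the blocks: the top-left block is the "$-A(z)$" block. $R_{in}(z)=B(zA_1-A_0)^{-1}C$ being a minimal generalized state-space realization means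 that $A_1,A_0,B,C$ are constant complex matrices of compatible sizes, $zA_1-A_0$ is regular, and the linear system matrix $\begin{bmatrix}-(zA_1-A_0)&C\\ B&0\end{bmatrix}$ is minimal. *)

theory Defs
  imports
    "HOL-Computational_Algebra.Computational_Algebra"
    "HOL-Computational_Algebra.Field_as_Ring"
    "Jordan_Normal_Form.DL_Rank"
    "Jordan_Normal_Form.Gauss_Jordan_Elimination"
    "Jordan_Normal_Form.Schur_Decomposition"
begin

text \<open>
  The field of rational functions is the fraction field \<^typ>\<open>complex poly fract\<close>; polynomial and
  rational matrices are matrices (of arbitrary size, including empty ones) over
  \<^typ>\<open>complex poly\<close> and \<^typ>\<open>complex poly fract\<close>. The conjugate transpose of a constant matrix is
  the library's \<^const>\<open>mat_adjoint\<close>, and \<^const>\<open>quot_of_fract\<close> is the reduced representation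
  as a pair of numerator and denominator.
\<close>

subsection \<open>Rational functions\<close>

definition rat_num :: "complex poly fract \<Rightarrow> complex poly" where
  "rat_num r = fst (quot_of_fract r)"

definition rat_den :: "complex poly fract \<Rightarrow> complex poly" where
  "rat_den r = snd (quot_of_fract r)"

text \<open>The value is meaningful only where \<open>r\<close> has no pole.\<close>

definition rat_eval :: "complex poly fract \<Rightarrow> complex \<Rightarrow> complex" where
  "rat_eval r z = poly (rat_num r) z / poly (rat_den r) z"

definition rat_pole :: "complex poly fract \<Rightarrow> complex \<Rightarrow> bool" where
  "rat_pole r z \<longleftrightarrow> poly (rat_den r) z = 0"

text \<open>\<open>rat_cnj r\<close> conjugates the coefficients only, that is, it is the rational function
  \<open>z \<mapsto> cnj (r (cnj z))\<close>.\<close>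

definition rat_cnj :: "complex poly fract \<Rightarrow> complex poly fract" where
  "rat_cnj r = to_fract (map_poly cnj (rat_num r)) / to_fract (map_poly cnj (rat_den r))"

abbreviation Z :: "complex poly" where
  "Z \<equiv> [:0, 1:]"

text \<open>The rational function \<open>r (1 / z)\<close>: numerator and denominator, with their coefficients read as
  constant rational functions, are evaluated at the element \<open>1 / z\<close> of the field of rational
  functions.\<close>

definition rat_recip :: "complex poly fract \<Rightarrow> complex poly fract" where
  "rat_recip r =
     poly (map_poly (\<lambda>c. to_fract [:c:]) (rat_num r)) (1 / to_fract Z) /
     poly (map_poly (\<lambda>c. to_fract [:c:]) (rat_den r)) (1 / to_fract Z)"


subsection \<open>Rational matrices\<close>

abbreviation const_mat :: "complex mat \<Rightarrow> complex poly mat" where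
  "const_mat M \<equiv> map_mat (\<lambda>c. [:c:]) M"

abbreviation rat_mat :: "complex poly mat \<Rightarrow> complex poly fract mat" where
  "rat_mat M \<equiv> map_mat to_fract M"

definition rat_mat_star :: "complex poly fract mat \<Rightarrow> complex poly fract mat" where
  "rat_mat_star R = transpose_mat (map_mat rat_cnj R)"

definition rat_mat_recip :: "complex poly fract mat \<Rightarrow> complex poly fract mat" where
  "rat_mat_recip R = map_mat rat_recip R"

definition para_hermitian :: "complex poly fract mat \<Rightarrow> bool" where
  "para_hermitian R \<longleftrightarrow> square_mat R \<and> rat_mat_star R = rat_mat_recip R"

definition mat_pole :: "complex poly fract mat \<Rightarrow> complex \<Rightarrow> bool" where
  "mat_pole R z \<longleftrightarrow> (\<exists>i < dim_row R. \<exists>j < dim_col R. rat_pole (R $$ (i, j)) z)"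

definition strictly_proper :: "complex poly fract mat \<Rightarrow> bool" where
  "strictly_proper R \<longleftrightarrow>
     (\<forall>i < dim_row R. \<forall>j < dim_col R. (rat_eval (R $$ (i, j)) \<longlongrightarrow> 0) at_infinity)"

text \<open>The inverse over the field of rational functions; used only when the determinant is
  nonzero.\<close>

abbreviation rat_mat_inv :: "complex poly fract mat \<Rightarrow> complex poly fract mat" where
  "rat_mat_inv M \<equiv> the (mat_inverse M)"


subsection \<open>Pencils\<close>

definition pencil :: "complex poly mat \<Rightarrow> bool" where
  "pencil L \<longleftrightarrow> (\<exists>L1 L0. L1 \<in> carrier_mat (dim_row L) (dim_col L) \<and>
     L0 \<in> carrier_mat (dim_row L) (dim_col L) \<and> L = Z \<cdot>\<^sub>m const_mat L1 + const_mat L0)"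

definition rev1 :: "complex poly fract mat \<Rightarrow> complex poly fract mat" where
  "rev1 H = to_fract Z \<cdot>\<^sub>m rat_mat_recip H"

definition star_palindromic :: "complex poly mat \<Rightarrow> bool" where
  "star_palindromic L \<longleftrightarrow>
     square_mat L \<and> pencil L \<and> rev1 (rat_mat_star (rat_mat L)) = rat_mat L"

definition eval_mat :: "complex poly mat \<Rightarrow> complex \<Rightarrow> complex mat" where
  "eval_mat L z = map_mat (\<lambda>p. poly p z) L"

definition lead_mat :: "complex poly mat \<Rightarrow> complex mat" where
  "lead_mat L = map_mat (\<lambda>p. coeff p 1) L"


subsection \<open>Linear system matrices\<close>

definition append_cols :: "'a :: zero mat \<Rightarrow> 'a mat \<Rightarrow> 'a mat" (infixr \<open>@\<^sub>c\<close> 65) where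
  "A @\<^sub>c B = four_block_mat A B (0\<^sub>m 0 (dim_col A)) (0\<^sub>m 0 (dim_col B))"

definition full_row_rank :: "complex mat \<Rightarrow> bool" where
  "full_row_rank M \<longleftrightarrow> vec_space.rank (dim_row M) M = dim_row M"

definition full_col_rank :: "complex mat \<Rightarrow> bool" where
  "full_col_rank M \<longleftrightarrow> vec_space.rank (dim_row M) M = dim_col M"

text \<open>A block-partitioned pencil is given by the whole pencil \<open>L\<close> and the size \<open>n\<close> of its square
  top-left block, which is the block \<open>-A(z)\<close>.\<close>

definition blk_A :: "nat \<Rightarrow> complex poly mat \<Rightarrow> complex poly mat" where
  "blk_A n L = (case split_block L n n of (N, B, C, D) \<Rightarrow> - N)"

definition blk_B :: "nat \<Rightarrow> complex poly mat \<Rightarrow> complex poly mat" where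
  "blk_B n L = (case split_block L n n of (N, B, C, D) \<Rightarrow> B)"

definition blk_C :: "nat \<Rightarrow> complex poly mat \<Rightarrow> complex poly mat" where
  "blk_C n L = (case split_block L n n of (N, B, C, D) \<Rightarrow> C)"

definition blk_D :: "nat \<Rightarrow> complex poly mat \<Rightarrow> complex poly mat" where
  "blk_D n L = (case split_block L n n of (N, B, C, D) \<Rightarrow> D)"

definition linear_system_matrix :: "nat \<Rightarrow> complex poly mat \<Rightarrow> bool" where
  "linear_system_matrix n L \<longleftrightarrow>
     n \<le> dim_row L \<and> n \<le> dim_col L \<and> pencil L \<and> det (blk_A n L) \<noteq> 0"

definition transfer_function :: "nat \<Rightarrow> complex poly mat \<Rightarrow> complex poly fract mat" where
  "transfer_function n L =
     rat_mat (blk_D n L) + rat_mat (blk_C n L) * rat_mat_inv (rat_mat (blk_A n L)) * rat_mat (blk_B n L)"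

definition minimal_lsm :: "nat \<Rightarrow> complex poly mat \<Rightarrow> bool" where
  "minimal_lsm n L \<longleftrightarrow> linear_system_matrix n L \<and>
     (\<forall>z0. full_row_rank (eval_mat (- blk_A n L) z0 @\<^sub>c eval_mat (blk_B n L) z0) \<and>
           full_col_rank (eval_mat (- blk_A n L) z0 @\<^sub>r eval_mat (blk_C n L) z0))"

definition minimal_at_infinity :: "nat \<Rightarrow> complex poly mat \<Rightarrow> bool" where
  "minimal_at_infinity n L \<longleftrightarrow> linear_system_matrix n L \<and>
     full_row_rank (lead_mat (- blk_A n L) @\<^sub>c lead_mat (blk_B n L)) \<and>
     full_col_rank (lead_mat (- blk_A n L) @\<^sub>r lead_mat (blk_C n L))"

definition strongly_minimal :: "nat \<Rightarrow> complex poly mat \<Rightarrow> bool" where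
  "strongly_minimal n L \<longleftrightarrow> minimal_lsm n L \<and> minimal_at_infinity n L"

definition strongly_minimal_linearization ::
    "nat \<Rightarrow> complex poly mat \<Rightarrow> complex poly fract mat \<Rightarrow> bool" where
  "strongly_minimal_linearization n L H \<longleftrightarrow> strongly_minimal n L \<and> transfer_function n L = H"

text \<open>\<open>H(z) = B (z A1 - A0)\<inverse> C\<close> with \<open>n \<times> n\<close> matrices \<open>A1\<close>, \<open>A0\<close>. Regularity of \<open>z A1 - A0\<close> is
  part of \<^const>\<open>minimal_lsm\<close>.\<close>

definition minimal_gss_realization ::
    "nat \<Rightarrow> complex mat \<Rightarrow> complex mat \<Rightarrow> complex mat \<Rightarrow> complex mat \<Rightarrow>
     complex poly fract mat \<Rightarrow> bool" where
  "minimal_gss_realization n A1 A0 B C H \<longleftrightarrow>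
     A1 \<in> carrier_mat n n \<and> A0 \<in> carrier_mat n n \<and>
     B \<in> carrier_mat (dim_row H) n \<and> C \<in> carrier_mat n (dim_col H) \<and>
     minimal_lsm n (four_block_mat (- (Z \<cdot>\<^sub>m const_mat A1 - const_mat A0)) (const_mat C)
                                   (const_mat B) (0\<^sub>m (dim_row H) (dim_col H))) \<and>
     H = rat_mat (const_mat B) * rat_mat_inv (rat_mat (Z \<cdot>\<^sub>m const_mat A1 - const_mat A0))
           * rat_mat (const_mat C)"

end

theory Submission
  imports Defs
begin

text \<open>
  Conjugating the coefficients and substituting \<open>1 / z\<close> exchanges the inside and the outside of the unit
  circle, so para-Hermitianness forces \<open>Rout(z) = Rin\<^sup>*(1 / z)\<close>: in the variable
  \<open>1 / z\<close>, the difference of the two sides would have its poles both inside and outside the circle, hence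
  is a polynomial, and it is strictly proper. Consequently \<open>Rout(z) = z C\<^sup>* (A1\<^sup>* - z A0\<^sup>*)\<inverse> B\<^sup>*\<close>, and inverting the
  block matrix gives the transfer function.

  For minimality, a point where a minimal system matrix has a singular state pencil is a pole of its
  transfer function. Thus \<open>z A1 - A0\<close>, \<open>A1\<^sup>* - z A0\<^sup>*\<close> and \<open>Ap(z)\<close> can be singular only inside, outside
  and on the unit circle, respectively. At every point at least two of the three diagonal systems are
  therefore nonsingular, and a kernel vector of the combined pencil lies in the third one, which
  is minimal. The conditions at infinity are the adjoints of those at \<open>0\<close>.
\<close>

unbundle no fps_syntax

subsection \<open>Ranks and kernels\<close>

text \<open>The factors \<open>z\<close> and \<open>1 + z\<close> of the pencil vanish at
  \<open>0\<close> and \<open>-1\<close>, so there the blocks carrying them contribute nothing to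
  the rank. At \<open>-1\<close> this is harmless, since neither the inner nor the outer state
  pencil is singular on the unit circle. At \<open>0\<close> the outer state pencil is, up to sign,
  the adjoint of \<open>A1\<close>: the point \<open>0\<close> is the reflection of infinity, which
  the finite poles of \<open>Rin\<close> do not control, and this is where the invertibility of
  \<open>A1\<close> enters. All rank conditions are treated as statements about kernels. Full row
  rank becomes the kernel condition for the transposes, so one block argument serves both rows and
  columns. That singular points are poles is obtained without any canonical form, from constant
  Bezout identities and a comparison of determinants.\<close>

lemma full_col_rank_iff:
  assumes M: "M \<in> carrier_mat nr nc"
  shows "full_col_rank M \<longleftrightarrow> (\<forall>v \<in> carrier_vec nc. M *\<^sub>v v = 0\<^sub>v nr \<longrightarrow> v = 0\<^sub>v nc)"
proof -
  interpret vec_space "TYPE(complex)" nr .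
  have dim: "dim_row M = nr" "dim_col M = nc" using M by auto
  show ?thesis
  proof
    assume "full_col_rank M"
    then have r: "rank M = nc" by (simp add: full_col_rank_def dim)
    obtain S where S: "maximal S (\<lambda>T. T \<subseteq> set (cols M) \<and> lin_indpt T)"
      using maximal_exists_superset[of "set (cols M)" "\<lambda>T. T \<subseteq> set (cols M) \<and> lin_indpt T" "{}"]
      by (auto simp: finite_lin_indpt2)
    \<comment> \<open>Independence concerns the set of columns, which forgets repetitions;
      \<open>nc\<close> independent vectors among them force all columns to be distinct.\<close>
    have "card S \<le> card (set (cols M))" using S by (auto simp: maximal_def intro!: card_mono)
    moreover have "card S = nc" using rank_card_indpt[OF M S] r by simp
    ultimately have "distinct (cols M)"
      using card_length[of "cols M"] M by (intro card_distinct) auto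
    moreover from this have "lin_indpt (set (cols M))" using full_rank_lin_indpt[OF M r] by simp
    ultimately show "\<forall>v \<in> carrier_vec nc. M *\<^sub>v v = 0\<^sub>v nr \<longrightarrow> v = 0\<^sub>v nc"
      using lin_depI[OF M] by blast
  next
    assume inj: "\<forall>v \<in> carrier_vec nc. M *\<^sub>v v = 0\<^sub>v nr \<longrightarrow> v = 0\<^sub>v nc"
    have d: "distinct (cols M)"
    proof (rule ccontr)
      assume "\<not> distinct (cols M)"
      then obtain i j where ij: "i < nc" "j < nc" "i \<noteq> j" "col M i = col M j"
        using dim by (auto simp: distinct_conv_nth)
      \<comment> \<open>Two equal columns make the difference of the corresponding unit vectors a
        nonzero kernel vector.\<close>
      let ?v = "unit_vec nc i - unit_vec nc j :: complex vec"
      have "M *\<^sub>v ?v = M *\<^sub>v unit_vec nc i - M *\<^sub>v unit_vec nc j"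
        by (rule mult_minus_distrib_mat_vec[OF M]) auto
      also have "M *\<^sub>v unit_vec nc i = col M i" using ij(1) M by (intro eq_vecI) (simp_all add: scalar_prod_right_unit)
      also have "M *\<^sub>v unit_vec nc j = col M i" unfolding ij(4) using ij(2) M by (intro eq_vecI) (simp_all add: scalar_prod_right_unit)
      also have "col M i - col M i = 0\<^sub>v nr" using M by (intro minus_cancel_vec) auto
      finally have "?v = 0\<^sub>v nc" using inj by auto
      then have "?v $ i = 0" using ij by simp
      then show False using ij by simp
    qed
    moreover have "lin_indpt (set (cols M))" using lin_depE[OF M _ d] inj by blast
    ultimately show "full_col_rank M"
      using lin_indpt_full_rank[OF M] by (simp add: full_col_rank_def dim)
  qed
qed

text \<open>The Gram matrix \<open>H * M\<close>, with \<open>H\<close> the conjugate transpose of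
  \<open>M\<close>, is nonsingular: a vector \<open>v\<close> in its kernel gives \<open>M v\<close>
  the square norm \<open>0\<close>. Its inverse times \<open>H\<close> is the left inverse.\<close>

lemma left_inverse_if_injective:
  fixes M :: "complex mat"
  assumes M: "M \<in> carrier_mat nr nc"
    and inj: "\<And>v. v \<in> carrier_vec nc \<Longrightarrow> M *\<^sub>v v = 0\<^sub>v nr \<Longrightarrow> v = 0\<^sub>v nc"
  shows "\<exists>X \<in> carrier_mat nc nr. X * M = 1\<^sub>m nc"
proof -
  define H where "H = transpose_mat (map_mat cnj M)"
  have H: "H \<in> carrier_mat nc nr" using M by (simp add: H_def)
  have HM: "H * M \<in> carrier_mat nc nc" using H M by auto
  have "det (H * M) \<noteq> 0"
  proof
    assume "det (H * M) = 0"
    then obtain v where v: "v \<in> carrier_vec nc" "v \<noteq> 0\<^sub>v nc" "(H * M) *\<^sub>v v = 0\<^sub>v nc"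
      using det_0_iff_vec_prod_zero_field[OF HM] by blast
    have Mv: "M *\<^sub>v v \<in> carrier_vec nr" using M v by auto
    have "conjugate (M *\<^sub>v v) = map_mat cnj M *\<^sub>v conjugate v"
      using M v by (intro eq_vecI) (auto simp: scalar_prod_def)
    then have "conjugate (M *\<^sub>v v) \<bullet> (M *\<^sub>v v) = (map_mat cnj M *\<^sub>v conjugate v) \<bullet> (M *\<^sub>v v)"
      by simp
    also have "\<dots> = (M *\<^sub>v v) \<bullet> (map_mat cnj M *\<^sub>v conjugate v)"
      by (rule comm_scalar_prod[where n = nr]) (use M v in auto)
    also have "\<dots> = (H *\<^sub>v (M *\<^sub>v v)) \<bullet> conjugate v"
      unfolding H_def by (rule transpose_vec_mult_scalar[symmetric]) (use M v in auto)
    also have "H *\<^sub>v (M *\<^sub>v v) = 0\<^sub>v nc" using v H M by (simp flip: assoc_mult_mat_vec)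
    also have "0\<^sub>v nc \<bullet> conjugate v = 0" using v by simp
    finally have "(M *\<^sub>v v) \<bullet>c (M *\<^sub>v v) = 0" using Mv comm_scalar_prod[of "conjugate (M *\<^sub>v v)" nr "M *\<^sub>v v"]
      by simp
    then have "M *\<^sub>v v = 0\<^sub>v nr" using Mv by simp
    with inj v show False by blast
  qed
  then obtain Y where Y: "Y \<in> carrier_mat nc nc" "Y * (H * M) = 1\<^sub>m nc"
    using det_non_zero_imp_unit[OF HM] by (auto simp: Units_def ring_mat_def)
  have "(Y * H) * M = 1\<^sub>m nc" using Y H M by (simp add: assoc_mult_mat)
  then show ?thesis using Y H by (intro bexI[of _ "Y * H"]) auto
qed

text \<open>Forward, \<open>nr\<close> independent columns form a square nonsingular matrix
  \<open>N\<close>, and a vector orthogonal to all columns lies in the kernel of its transpose.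
  Backward, a left inverse of the transpose turns into a right inverse of \<open>M\<close>, so the
  columns span the whole space.\<close>

lemma full_row_rank_iff:
  assumes M: "M \<in> carrier_mat nr nc"
  shows "full_row_rank M \<longleftrightarrow>
    (\<forall>v \<in> carrier_vec nr. transpose_mat M *\<^sub>v v = 0\<^sub>v nc \<longrightarrow> v = 0\<^sub>v nr)"
proof -
  interpret vec_space "TYPE(complex)" nr .
  have dim: "dim_row M = nr" "dim_col M = nc" using M by auto
  show ?thesis
  proof
    assume "full_row_rank M"
    then have r: "rank M = nr" by (simp add: full_row_rank_def dim)
    obtain S where S: "maximal S (\<lambda>T. T \<subseteq> set (cols M) \<and> lin_indpt T)"
      using maximal_exists_superset[of "set (cols M)" "\<lambda>T. T \<subseteq> set (cols M) \<and> lin_indpt T" "{}"]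
      by (auto simp: finite_lin_indpt2)
    then have sub: "S \<subseteq> set (cols M)" and li: "lin_indpt S" by (auto simp: maximal_def)
    have "card S = nr" using rank_card_indpt[OF M S] r by simp
    moreover obtain xs where xs: "set xs = S" "distinct xs"
      using finite_distinct_list[of S] sub finite_subset by blast
    ultimately have len: "length xs = nr" using distinct_card by metis
    have xsc: "set xs \<subseteq> carrier_vec nr" using xs sub cols_dim[of M] dim by auto
    define N where "N = mat_of_cols nr xs"
    have N: "N \<in> carrier_mat nr nr" and cN: "cols N = xs"
      using len xsc by (auto simp: N_def)
    have "det N \<noteq> 0" using lin_indpt_full_rank[OF N] li xs cN det_rank_iff[OF N] by simp
    then have det: "det (transpose_mat N) \<noteq> 0" using det_transpose[OF N] by simp
    have "v = 0\<^sub>v nr" if v: "v \<in> carrier_vec nr" and 0: "transpose_mat M *\<^sub>v v = 0\<^sub>v nc" for v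
    proof -
      have orth: "w \<bullet> v = 0" if "w \<in> set (cols M)" for w
      proof -
        obtain j where j: "j < nc" "w = col M j" using \<open>w \<in> set (cols M)\<close> dim by (auto simp: cols_def)
        have "(transpose_mat M *\<^sub>v v) $ j = w \<bullet> v" using j M by simp
        then show ?thesis using 0 j by simp
      qed
      have "transpose_mat N *\<^sub>v v = 0\<^sub>v nr"
      proof (rule eq_vecI)
        fix i assume "i < dim_vec (0\<^sub>v nr :: complex vec)"
        then have i: "i < nr" by simp
        then have "(transpose_mat N *\<^sub>v v) $ i = col N i \<bullet> v" using N by simp
        also have "col N i \<in> set (cols M)"
          using cN xs sub i N len by (metis carrier_matD(2) cols_nth nth_mem subsetD)
        then have "col N i \<bullet> v = 0" by (rule orth)
        finally show "(transpose_mat N *\<^sub>v v) $ i = 0\<^sub>v nr $ i" using i by simp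
      qed (use N in auto)
      then show ?thesis
        using det det_0_iff_vec_prod_zero_field[of "transpose_mat N" nr] N v by auto
    qed
    then show "\<forall>v \<in> carrier_vec nr. transpose_mat M *\<^sub>v v = 0\<^sub>v nc \<longrightarrow> v = 0\<^sub>v nr" by blast
  next
    assume "\<forall>v \<in> carrier_vec nr. transpose_mat M *\<^sub>v v = 0\<^sub>v nc \<longrightarrow> v = 0\<^sub>v nr"
    then obtain X where X: "X \<in> carrier_mat nr nc" "X * transpose_mat M = 1\<^sub>m nr"
      using left_inverse_if_injective[of "transpose_mat M" nc nr] M by auto
    have "transpose_mat (X * transpose_mat M) = M * transpose_mat X"
      by (subst transpose_mult[of _ nr nc _ nr]) (use X M in auto)
    then have MX: "M * transpose_mat X = 1\<^sub>m nr" using X by simp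
    have "col_space M = carrier_vec nr"
    proof -
      have "\<exists>x \<in> carrier_vec nc. M *\<^sub>v x = y" if y: "y \<in> carrier_vec nr" for y
      proof
        have "M *\<^sub>v (transpose_mat X *\<^sub>v y) = (M * transpose_mat X) *\<^sub>v y"
          by (rule assoc_mult_mat_vec[symmetric]) (use M X y in auto)
        then show "M *\<^sub>v (transpose_mat X *\<^sub>v y) = y" using MX y by simp
      qed (use X y in auto)
      then show ?thesis unfolding col_space_eq[OF M] dim by blast
    qed
    then have "span_vs (set (cols M)) = V" by (simp add: col_space_def)
    then show "full_row_rank M" using dim_is_n by (simp add: full_row_rank_def dim rank_def)
  qed
qed

subsection \<open>Rational functions\<close>

interpretation to_fract_hom: inj_idom_hom "to_fract :: 'a :: idom \<Rightarrow> 'a fract"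
  by standard auto

lemma rat_num_den: "r = to_fract (rat_num r) / to_fract (rat_den r)"
  unfolding rat_num_def rat_den_def by (metis Fract_conv_to_fract Fract_quot_of_fract)

lemma rat_den_nonzero [simp]: "rat_den r \<noteq> 0"
  by (simp add: rat_den_def)

lemma rat_num_cross:
  assumes "r = to_fract a / to_fract b" and "b \<noteq> 0"
  shows "rat_num r * b = a * rat_den r"
proof -
  have "to_fract (rat_num r) / to_fract (rat_den r) = to_fract a / to_fract b"
    using rat_num_den[of r] assms by simp
  then have "to_fract (rat_num r * b) = to_fract (a * rat_den r)"
    using assms by (simp add: frac_eq_eq to_fract_hom.hom_mult)
  then show ?thesis by (simp only: to_fract_eq_iff)
qed

lemma rat_fractE:
  fixes r :: "complex poly fract"
  obtains a b where "r = to_fract a / to_fract b" and "b \<noteq> 0"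
  by (rule that[OF rat_num_den rat_den_nonzero])

text \<open>The reduced denominator is coprime to the numerator, so cross-multiplication makes it
  divide every other denominator.\<close>

lemma rat_den_dvd:
  assumes "r = to_fract a / to_fract b" and "b \<noteq> 0"
  shows "rat_den r dvd b"
proof -
  have "coprime (rat_den r) (rat_num r)"
    unfolding rat_num_def rat_den_def using coprime_quot_of_fract coprime_commute by blast
  moreover have "rat_den r dvd rat_num r * b" using rat_num_cross[OF assms] by simp
  ultimately show ?thesis by (simp add: coprime_dvd_mult_right_iff)
qed

text \<open>The common shape of \<open>rat_cnj\<close> and \<open>rat_recip\<close>: the extension
  of a map on polynomials to the fraction field. It is stated with the reduced representation so
  that both are literally instances of it.\<close>

definition fract_ext :: "(complex poly \<Rightarrow> complex poly fract) \<Rightarrow> complex poly fract \<Rightarrow> complex poly fract" where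
  "fract_ext h r = h (rat_num r) / h (rat_den r)"

locale poly_embedding = inj_comm_ring_hom h for h :: "complex poly \<Rightarrow> complex poly fract"
begin

text \<open>Injectivity of \<open>h\<close> keeps denominators nonzero, so the value does not depend
  on the chosen representation. The field homomorphism laws then follow from the usual rules for
  fractions.\<close>

lemma fract_ext_divide:
  assumes "b \<noteq> 0"
  shows "fract_ext h (to_fract a / to_fract b) = h a / h b"
proof -
  let ?r = "to_fract a / to_fract b"
  have "h (rat_num ?r) * h b = h a * h (rat_den ?r)"
    using rat_num_cross[OF refl assms, of a] by (metis hom_mult)
  then show ?thesis using assms by (simp add: fract_ext_def frac_eq_eq)
qed

lemma fract_ext_to_fract [simp]: "fract_ext h (to_fract p) = h p"
  using fract_ext_divide[of 1 p] by simp

sublocale ext: field_hom "fract_ext h"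
proof
  fix x y :: "complex poly fract"
  obtain a b where x: "x = to_fract a / to_fract b" "b \<noteq> 0" by (rule rat_fractE[of x])
  obtain c d where y: "y = to_fract c / to_fract d" "d \<noteq> 0" by (rule rat_fractE[of y])
  have "x + y = to_fract (a * d + c * b) / to_fract (b * d)"
    using x y by (simp add: add_frac_eq to_fract_hom.hom_mult to_fract_hom.hom_add)
  then have "fract_ext h (x + y) = h (a * d + c * b) / h (b * d)"
    using fract_ext_divide[of "b * d" "a * d + c * b"] x(2) y(2) by simp
  then show "fract_ext h (x + y) = fract_ext h x + fract_ext h y"
    using x y by (simp add: fract_ext_divide add_frac_eq hom_mult hom_add)
  have "x * y = to_fract (a * c) / to_fract (b * d)"
    using x y by (simp add: to_fract_hom.hom_mult)
  then have "fract_ext h (x * y) = h (a * c) / h (b * d)"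
    using fract_ext_divide[of "b * d" "a * c"] x(2) y(2) by simp
  then show "fract_ext h (x * y) = fract_ext h x * fract_ext h y"
    using x y by (simp add: fract_ext_divide hom_mult)
next
  show "fract_ext h 1 = 1" using fract_ext_to_fract[of 1] by simp
  show "fract_ext h 0 = 0" using fract_ext_to_fract[of 0] by simp
qed

end

section \<open>The substitution of \<open>1 / z\<close> and the conjugation of coefficients\<close>

definition poly_recip :: "complex poly \<Rightarrow> complex poly fract" where
  "poly_recip p = poly (map_poly (\<lambda>c. to_fract [:c:]) p) (1 / to_fract Z)"

interpretation const_hom: comm_ring_hom "\<lambda>c :: complex. to_fract [:c:]"
  by standard (simp_all flip: to_fract_hom.hom_add to_fract_hom.hom_mult add: to_fract_hom.hom_zero one_pCons[symmetric])

interpretation const_poly_hom: map_poly_comm_ring_hom "\<lambda>c :: complex. to_fract [:c:]" ..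

lemma poly_recip_pCons: "poly_recip (pCons a p) = to_fract [:a:] + 1 / to_fract Z * poly_recip p"
  by (cases "pCons a p = 0") (auto simp: poly_recip_def map_poly_pCons)

text \<open>Clearing the powers of \<open>1 / z\<close> leaves the polynomial with reversed
  coefficients. This yields the injectivity of the substitution and later its effect on poles and
  degrees.\<close>

lemma poly_recip_reflect: "poly_recip p * to_fract Z ^ degree p = to_fract (reflect_poly p)"
proof (induction p)
  case (pCons a p)
  show ?case
  proof (cases "p = 0")
    case False
    have "poly_recip (pCons a p) * to_fract Z ^ degree (pCons a p) =
        to_fract [:a:] * to_fract Z ^ Suc (degree p) + poly_recip p * to_fract Z ^ degree p"
      using False by (simp add: poly_recip_pCons algebra_simps)
    also have "\<dots> = to_fract ([:a:] * Z ^ Suc (degree p) + reflect_poly p)"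
      by (simp add: pCons.IH to_fract_hom.hom_add to_fract_hom.hom_mult to_fract_hom.hom_power del: mult_pCons_left)
    also have "[:a:] * Z ^ Suc (degree p) = monom a (Suc (degree p))"
      by (simp add: monom_altdef)
    finally show ?thesis using False by (simp add: reflect_poly_pCons' add.commute)
  qed (simp add: poly_recip_pCons, simp add: poly_recip_def)
qed (simp add: poly_recip_def)

interpretation recip: poly_embedding poly_recip
proof
  fix p q
  show "poly_recip (p + q) = poly_recip p + poly_recip q"
    by (simp add: poly_recip_def const_poly_hom.hom_add)
  show "poly_recip (p * q) = poly_recip p * poly_recip q"
    by (simp add: poly_recip_def const_poly_hom.hom_mult)
  show "poly_recip p = 0 \<Longrightarrow> p = 0" using poly_recip_reflect[of p] by simp
qed (simp_all add: poly_recip_def)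

interpretation cnjp: poly_embedding "\<lambda>p. to_fract (map_poly cnj p)"
proof -
  interpret c: field_hom cnj by standard auto
  interpret cp: map_poly_inj_comm_ring_hom cnj ..
  show "poly_embedding (\<lambda>p. to_fract (map_poly cnj p))"
    by standard (auto simp: to_fract_hom.hom_add to_fract_hom.hom_mult cp.hom_add cp.hom_mult)
qed

lemma rat_recip_ext: "rat_recip = fract_ext poly_recip"
  by (rule ext) (simp add: rat_recip_def fract_ext_def poly_recip_def)

lemma rat_cnj_ext: "rat_cnj = fract_ext (\<lambda>p. to_fract (map_poly cnj p))"
  by (rule ext) (simp add: rat_cnj_def fract_ext_def)

interpretation rat_recip: field_hom rat_recip
  unfolding rat_recip_ext by (rule recip.ext.field_hom_axioms)

interpretation rat_cnj: field_hom rat_cnj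
  unfolding rat_cnj_ext by (rule cnjp.ext.field_hom_axioms)

lemmas rat_recip_divide = recip.fract_ext_divide[folded rat_recip_ext]
  and rat_recip_to_fract = recip.fract_ext_to_fract[folded rat_recip_ext]
  and rat_cnj_divide = cnjp.fract_ext_divide[folded rat_cnj_ext]
  and rat_cnj_to_fract = cnjp.fract_ext_to_fract[folded rat_cnj_ext]

lemma poly_recip_const [simp]: "poly_recip [:c:] = to_fract [:c:]"
  by (simp add: poly_recip_pCons)

lemma poly_recip_Z [simp]: "poly_recip Z = 1 / to_fract Z"
  by (simp add: poly_recip_pCons flip: one_pCons)

lemma rat_recip_poly_recip: "rat_recip (poly_recip p) = to_fract p"
proof (induction p)
  case (pCons a p)
  have "rat_recip (poly_recip (pCons a p)) = to_fract [:a:] + to_fract Z * to_fract p"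
    by (simp add: poly_recip_pCons rat_recip.hom_add rat_recip.hom_mult rat_recip.hom_div
        rat_recip_to_fract pCons.IH)
  also have "\<dots> = to_fract (pCons a p)" by (simp flip: to_fract_hom.hom_add to_fract_hom.hom_mult)
  finally show ?case .
qed simp

lemma rat_recip_rat_recip [simp]: "rat_recip (rat_recip r) = r"
proof -
  obtain a b where r: "r = to_fract a / to_fract b" "b \<noteq> 0" by (rule rat_fractE)
  then show ?thesis by (simp add: rat_recip_divide rat_recip.hom_div rat_recip_to_fract rat_recip_poly_recip)
qed

subsection \<open>Poles and strict properness\<close>

text \<open>Any representation whose denominator does not vanish at \<open>z\<close> certifies the
  absence of a pole. This spares the reduction to lowest terms in the closure properties
  below.\<close>

lemma not_rat_pole_iff:
  "\<not> rat_pole r z \<longleftrightarrow> (\<exists>a b. r = to_fract a / to_fract b \<and> poly b z \<noteq> 0)"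
proof
  assume "\<not> rat_pole r z"
  then show "\<exists>a b. r = to_fract a / to_fract b \<and> poly b z \<noteq> 0"
    using rat_num_den[of r] unfolding rat_pole_def by blast
next
  assume "\<exists>a b. r = to_fract a / to_fract b \<and> poly b z \<noteq> 0"
  then obtain a b where r: "r = to_fract a / to_fract b" "poly b z \<noteq> 0" by blast
  then have "rat_den r dvd b" by (intro rat_den_dvd) auto
  with r(2) show "\<not> rat_pole r z" by (auto simp: rat_pole_def elim!: dvdE)
qed

lemma not_rat_poleI: "poly b z \<noteq> 0 \<Longrightarrow> \<not> rat_pole (to_fract a / to_fract b) z"
  using not_rat_pole_iff by blast

lemma not_rat_pole_to_fract [simp]: "\<not> rat_pole (to_fract p) z"
  using not_rat_poleI[of 1 z p] by simp

lemma not_rat_pole_add: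
  assumes "\<not> rat_pole r z" and "\<not> rat_pole s z"
  shows "\<not> rat_pole (r + s) z"
proof -
  obtain a b c d where r: "r = to_fract a / to_fract b" "poly b z \<noteq> 0"
    and s: "s = to_fract c / to_fract d" "poly d z \<noteq> 0"
    using assms unfolding not_rat_pole_iff by blast
  then have "b \<noteq> 0" "d \<noteq> 0" by auto
  then have "r + s = to_fract (a * d + c * b) / to_fract (b * d)"
    using r s by (simp add: add_frac_eq)
  then show ?thesis using not_rat_poleI[of "b * d" z "a * d + c * b"] r s by simp
qed

lemma not_rat_pole_mult:
  assumes "\<not> rat_pole r z" and "\<not> rat_pole s z"
  shows "\<not> rat_pole (r * s) z"
proof -
  obtain a b c d where r: "r = to_fract a / to_fract b" "poly b z \<noteq> 0"
    and s: "s = to_fract c / to_fract d" "poly d z \<noteq> 0"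
    using assms unfolding not_rat_pole_iff by blast
  then have "r * s = to_fract (a * c) / to_fract (b * d)" by simp
  then show ?thesis using not_rat_poleI[of "b * d" z "a * c"] r s by simp
qed

lemma not_rat_pole_diff:
  assumes "\<not> rat_pole r z" and "\<not> rat_pole s z"
  shows "\<not> rat_pole (r - s) z"
proof -
  have "\<not> rat_pole (to_fract [:-1:] * s) z" by (rule not_rat_pole_mult) (use assms in auto)
  moreover have "to_fract [:-1:] * s = - s"
    using to_fract_hom.hom_uminus[of "1 :: complex poly"] by (simp add: one_pCons)
  ultimately show ?thesis using not_rat_pole_add[OF assms(1), of "- s"] by simp
qed

text \<open>The algebraic counterpart of vanishing at infinity, for an arbitrary representation. The
  zero numerator is listed separately because the degree of the zero polynomial is
  \<open>0\<close>.\<close>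

definition proper0 :: "complex poly fract \<Rightarrow> bool" where
  "proper0 r \<longleftrightarrow> (\<exists>a b. r = to_fract a / to_fract b \<and> b \<noteq> 0 \<and> (a = 0 \<or> degree a < degree b))"

lemma proper0_diff:
  assumes "proper0 r" and "proper0 s"
  shows "proper0 (r - s)"
proof -
  obtain a b c d where r: "r = to_fract a / to_fract b" "b \<noteq> 0" "a = 0 \<or> degree a < degree b"
    and s: "s = to_fract c / to_fract d" "d \<noteq> 0" "c = 0 \<or> degree c < degree d"
    using assms unfolding proper0_def by blast
  have "r - s = to_fract (a * d - c * b) / to_fract (b * d)"
    using r s by (simp add: diff_frac_eq to_fract_hom.hom_minus)
  moreover have "a * d - c * b = 0 \<or> degree (a * d - c * b) < degree (b * d)"
  \<comment> \<open>A constant denominator leaves no room for a strictly smaller degree, so in that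
    case both numerators are \<open>0\<close>.\<close>
  proof (cases "degree (b * d) = 0")
    case True
    then show ?thesis using r s by (auto simp: degree_mult_eq)
  next
    case False
    have "degree (a * d) < degree (b * d)" "degree (c * b) < degree (b * d)"
      using r s False by (auto simp: degree_mult_eq[of b d] intro: le_less_trans[OF degree_mult_le])
    then show ?thesis by (simp add: degree_diff_less)
  qed
  ultimately show ?thesis using r s unfolding proper0_def by (metis mult_eq_0_iff)
qed

text \<open>An algebraic Liouville argument: without poles the reduced denominator is constant by
  the fundamental theorem of algebra, and a nonzero polynomial does not vanish at infinity.\<close>

lemma proper0_without_poles:
  assumes "proper0 r" and "\<And>z. \<not> rat_pole r z"
  shows "r = 0"
proof -
  obtain a b where r: "r = to_fract a / to_fract b" "b \<noteq> 0" "a = 0 \<or> degree a < degree b"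
    using assms(1) unfolding proper0_def by blast
  have "degree (rat_den r) = 0"
  proof (rule ccontr)
    assume "degree (rat_den r) \<noteq> 0"
    then have "\<not> constant (poly (rat_den r))" by (simp add: constant_degree)
    then show False using fundamental_theorem_of_algebra assms(2) unfolding rat_pole_def by blast
  qed
  have "rat_num r = 0"
  proof (rule ccontr)
    assume n: "rat_num r \<noteq> 0"
    then have "a \<noteq> 0" using rat_num_cross[OF r(1,2)] r(2) by auto
    moreover have "degree (rat_num r) + degree b = degree a + degree (rat_den r)"
      using arg_cong[OF rat_num_cross[OF r(1,2)], of degree] n r(2) \<open>a \<noteq> 0\<close>
      by (simp add: degree_mult_eq)
    ultimately show False using r(3) \<open>degree (rat_den r) = 0\<close> by simp
  qed
  then show "r = 0" using rat_num_den[of r] by simp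
qed

lemma proper0_if_tendsto_0:
  assumes "(rat_eval r \<longlongrightarrow> 0) at_infinity"
  shows "proper0 r"
proof (cases "rat_num r = 0 \<or> degree (rat_num r) < degree (rat_den r)")
  case True
  then show ?thesis using rat_num_den[of r] rat_den_nonzero unfolding proper0_def by blast
next
  case False
  let ?n = "rat_num r" and ?d = "rat_den r"
  from False have n: "?n \<noteq> 0" and deg: "degree ?d \<le> degree ?n" by auto
  define k where "k = degree ?n - degree ?d"
  \<comment> \<open>The product below equals \<open>poly ?n z / z ^ degree ?n\<close>, which tends to \<open>lead_coeff ?n \<noteq> 0\<close>.\<close>
  have "((\<lambda>z. rat_eval r z * (poly ?d z / z ^ degree ?d) * (1 / z ^ k)) \<longlongrightarrow> 0) at_infinity"
  proof -
    have *: "((\<lambda>z. rat_eval r z * (poly ?d z / z ^ degree ?d)) \<longlongrightarrow> 0 * lead_coeff ?d) at_infinity"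
      by (intro tendsto_mult assms poly_divide_tendsto_aux)
    show ?thesis
    proof (cases "k = 0")
      case False
      then have "((\<lambda>z::complex. 1 / z ^ k) \<longlongrightarrow> 0) at_infinity"
        by (intro tendsto_divide_0[OF tendsto_const] filterlim_power_at_infinity)
      from tendsto_mult[OF * this] show ?thesis by simp
    qed (use * in simp)
  qed
  moreover have "eventually (\<lambda>z. rat_eval r z * (poly ?d z / z ^ degree ?d) * (1 / z ^ k) =
      poly ?n z / z ^ degree ?n) at_infinity"
  proof -
    have "eventually (\<lambda>z. poly ?d z \<noteq> 0) at_infinity"
      by (rule eventually_mono[OF tendsto_imp_eventually_ne[OF poly_divide_tendsto_aux[of ?d], of 0]]) auto
    then show ?thesis
    proof eventually_elim
      case (elim z)
      have "degree ?n = degree ?d + k" using deg by (simp add: k_def)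
      then show ?case using elim by (simp add: rat_eval_def power_add)
    qed
  qed
  ultimately have "((\<lambda>z. poly ?n z / z ^ degree ?n) \<longlongrightarrow> 0) at_infinity"
    by (rule Lim_transform_eventually)
  \<comment> \<open>Points of arbitrarily large norm show that \<open>at_infinity\<close> is not the
    trivial filter, as uniqueness of limits demands.\<close>
  moreover have "\<not> (\<forall>x :: complex. b \<le> norm x \<longrightarrow> False)" for b
    by (auto intro!: exI[of _ "of_real \<bar>b\<bar>"])
  then have "(at_infinity :: complex filter) \<noteq> bot"
    unfolding trivial_limit_def eventually_at_infinity by blast
  ultimately have "lead_coeff ?n = 0"
    using poly_divide_tendsto_aux[of ?n] tendsto_unique by blast
  with n show ?thesis by simp
qed

section \<open>Poles and degrees under conjugation and under the substitution of
  \<open>1 / z\<close>\<close>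

lemma poly_map_poly_cnj: "poly (map_poly cnj p) z = cnj (poly p (cnj z))"
  by (induction p) (simp_all add: map_poly_pCons)

lemma map_poly_cnj_const [simp]: "map_poly cnj [:c:] = [:cnj c:]"
  by (cases "c = 0") (simp_all add: map_poly_pCons)

lemma rat_pole_rat_cnj: "rat_pole (rat_cnj r) z \<Longrightarrow> rat_pole r (cnj z)"
proof (rule ccontr)
  assume z: "rat_pole (rat_cnj r) z" and "\<not> rat_pole r (cnj z)"
  then obtain a b where r: "r = to_fract a / to_fract b" "poly b (cnj z) \<noteq> 0"
    unfolding not_rat_pole_iff by blast
  then have "b \<noteq> 0" by auto
  then have "rat_cnj r = to_fract (map_poly cnj a) / to_fract (map_poly cnj b)"
    unfolding r(1) by (rule rat_cnj_divide)
  then show False using z not_rat_poleI[of "map_poly cnj b" z] r by (simp add: poly_map_poly_cnj)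
qed

lemma proper0_rat_cnj: "proper0 r \<Longrightarrow> proper0 (rat_cnj r)"
proof -
  have deg: "degree (map_poly cnj p) = degree p" for p by (rule degree_map_poly) simp
  have z: "map_poly cnj p = 0 \<longleftrightarrow> p = 0" for p by (subst map_poly_eq_0_iff) auto
  assume "proper0 r"
  then obtain a b where r: "r = to_fract a / to_fract b" "b \<noteq> 0" "a = 0 \<or> degree a < degree b"
    unfolding proper0_def by blast
  then have "rat_cnj r = to_fract (map_poly cnj a) / to_fract (map_poly cnj b)"
    unfolding r(1) by (intro rat_cnj_divide) (use r in simp)
  then show ?thesis using r deg z unfolding proper0_def by metis
qed

text \<open>The powers of \<open>Z\<close> that clear numerator and denominator are placed
  crosswise, which avoids a case distinction on which degree is larger.\<close>

lemma rat_recip_divide_reflect: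
  assumes "b \<noteq> 0"
  shows "rat_recip (to_fract a / to_fract b) =
    to_fract (reflect_poly a * Z ^ degree b) / to_fract (reflect_poly b * Z ^ degree a)"
proof -
  have "poly_recip b \<noteq> 0" using assms by simp
  then show ?thesis using assms
    by (simp add: rat_recip_divide frac_eq_eq to_fract_hom.hom_power flip: poly_recip_reflect)
qed

lemma rat_pole_rat_recip:
  assumes "rat_pole (rat_recip r) z" and "z \<noteq> 0"
  shows "rat_pole r (inverse z)"
proof (rule ccontr)
  assume "\<not> rat_pole r (inverse z)"
  then obtain a b where r: "r = to_fract a / to_fract b" "poly b (inverse z) \<noteq> 0"
    unfolding not_rat_pole_iff by blast
  then have "b \<noteq> 0" by auto
  have "poly (reflect_poly b * Z ^ degree a) z \<noteq> 0"
    using assms r by (simp add: poly_reflect_poly_nz)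
  then have "\<not> rat_pole (rat_recip r) z"
    unfolding r(1) rat_recip_divide_reflect[OF \<open>b \<noteq> 0\<close>] by (rule not_rat_poleI)
  with assms show False by simp
qed

text \<open>The point \<open>0\<close> is the image of infinity. After cancelling the power of
  \<open>Z\<close>, the denominator is \<open>reflect_poly b\<close>, whose value at
  \<open>0\<close> is the leading coefficient of \<open>b\<close>.\<close>

lemma not_rat_pole_rat_recip_0:
  assumes "proper0 r"
  shows "\<not> rat_pole (rat_recip r) 0"
proof -
  obtain a b where r: "r = to_fract a / to_fract b" "b \<noteq> 0" "a = 0 \<or> degree a < degree b"
    using assms(1) unfolding proper0_def by blast
  then have le: "degree a \<le> degree b" by auto
  have "Z ^ degree b = Z ^ (degree b - degree a) * Z ^ degree a" using le by (simp flip: power_add)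
  then have "rat_recip r = to_fract (reflect_poly a * Z ^ (degree b - degree a)) / to_fract (reflect_poly b)"
    unfolding r(1) rat_recip_divide_reflect[OF r(2)] by simp
  then show ?thesis by (simp only:) (rule not_rat_poleI, simp add: r(2))
qed

text \<open>A zero at \<open>0\<close> becomes a zero at infinity: reversal lowers the degree of a
  numerator with vanishing constant coefficient, but preserves that of a denominator whose constant
  coefficient is nonzero.\<close>

lemma proper0_rat_recip:
  assumes "\<not> rat_pole r 0" and "rat_eval r 0 = 0"
  shows "proper0 (rat_recip r)"
proof (cases "r = 0")
  case False
  let ?n = "rat_num r" and ?d = "rat_den r"
  have n: "?n \<noteq> 0" using False rat_num_den[of r] by auto
  have "poly ?d 0 \<noteq> 0" "poly ?n 0 = 0" using assms by (auto simp: rat_pole_def rat_eval_def)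
  then have d0: "coeff ?d 0 \<noteq> 0" and n0: "coeff ?n 0 = 0" by (simp_all add: poly_0_coeff_0)
  have "coeff (reflect_poly ?n) (degree ?n) = 0" using n0 by (simp add: coeff_reflect_poly)
  then have "degree (reflect_poly ?n) \<noteq> degree ?n" using n by (metis leading_coeff_0_iff reflect_poly_eq_0_iff)
  then have "degree (reflect_poly ?n) < degree ?n" using degree_reflect_poly_le[of ?n] by simp
  then have "degree (reflect_poly ?n * Z ^ degree ?d) < degree (reflect_poly ?d * Z ^ degree ?n)"
    using n d0 by (simp add: degree_mult_eq degree_power_eq)
  moreover have "reflect_poly ?d * Z ^ degree ?n \<noteq> 0" by simp
  moreover have "rat_recip r = to_fract (reflect_poly ?n * Z ^ degree ?d) / to_fract (reflect_poly ?d * Z ^ degree ?n)"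
    by (subst rat_num_den[of r]) (rule rat_recip_divide_reflect, simp)
  ultimately show ?thesis unfolding proper0_def by blast
next
  case True
  then have "rat_recip r = to_fract 0 / to_fract 1" by simp
  then show ?thesis unfolding proper0_def by (metis one_neq_zero)
qed

text \<open>The two sides of \<open>rat_cnj rin' - rat_recip rout = \<dots>\<close> have their poles inside and outside the
  open unit disk, respectively, so both are polynomials; the left one vanishes at infinity.\<close>

lemma para_hermitian_inner_outer:
  assumes eq: "rat_cnj (rin' + rout' + rs' + to_fract [:c':]) = rat_recip (rin + rout + rs + to_fract [:c:])"
    and rin: "proper0 rin" "\<And>z. rat_pole rin z \<Longrightarrow> norm z < 1"
    and rin': "proper0 rin'" "\<And>z. rat_pole rin' z \<Longrightarrow> norm z < 1"
    and rout: "rat_eval rout 0 = 0" "\<And>z. rat_pole rout z \<Longrightarrow> norm z > 1"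
    and rout': "\<And>z. rat_pole rout' z \<Longrightarrow> norm z > 1"
    and rs: "proper0 rs" "\<And>z. rat_pole rs z \<Longrightarrow> norm z = 1"
    and rs': "\<And>z. rat_pole rs' z \<Longrightarrow> norm z = 1"
  shows "rout = rat_recip (rat_cnj rin')"
proof -
  let ?f = "rat_cnj rin' - rat_recip rout"
  have f: "?f = rat_recip rin + rat_recip rs + to_fract [:c:] - rat_cnj rout' - rat_cnj rs' - to_fract [:cnj c':]"
    using eq by (simp add: rat_cnj.hom_add rat_recip.hom_add rat_cnj_to_fract rat_recip_to_fract algebra_simps)
  have "\<not> rat_pole ?f z" for z
  proof (cases "norm z < 1")
    case True
    \<comment> \<open>At \<open>z = 0\<close> the reflected point is infinity, so there strict
      properness takes the place of the condition on the poles.\<close>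
    have *: "\<not> rat_pole (rat_recip r) z" if "proper0 r" "\<And>z. rat_pole r z \<Longrightarrow> norm z \<le> 1" for r
    proof (cases "z = 0")
      case False
      then have "norm (inverse z) > 1" using True by (simp add: norm_inverse one_less_inverse_iff)
      then show ?thesis using that(2) rat_pole_rat_recip[OF _ False, of r] by force
    qed (use that not_rat_pole_rat_recip_0 in auto)
    have **: "\<not> rat_pole (rat_cnj r) z" if "\<And>z. rat_pole r z \<Longrightarrow> norm z \<ge> 1" for r
      using that[of "cnj z"] rat_pole_rat_cnj[of r z] True by auto
    show ?thesis unfolding f
      by (intro not_rat_pole_add not_rat_pole_diff * ** not_rat_pole_to_fract rin rs)
        (use rin(2) rs(2) rs' rout' in force)+
  next
    \<comment> \<open>The unit circle belongs to this case: \<open>?f\<close> itself involves only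
      \<open>rin'\<close> and \<open>rout\<close>, whose poles avoid the circle.\<close>
    case False
    then have "z \<noteq> 0" by auto
    have "norm (inverse z) \<le> 1" using False by (simp add: norm_inverse inverse_le_1_iff)
    then have "\<not> rat_pole (rat_recip rout) z"
      using rout(2) rat_pole_rat_recip[OF _ \<open>z \<noteq> 0\<close>, of rout] by force
    moreover have "\<not> rat_pole (rat_cnj rin') z"
      using rin'(2)[of "cnj z"] rat_pole_rat_cnj[of rin' z] False by auto
    ultimately show ?thesis by (intro not_rat_pole_diff)
  qed
  \<comment> \<open>The normalization of \<open>rout\<close> at \<open>0\<close> enters here; it
    rules out that the two sides differ by a constant.\<close>
  moreover have "proper0 ?f"
    using rout by (intro proper0_diff proper0_rat_cnj proper0_rat_recip rin') force+
  ultimately have "?f = 0" using proper0_without_poles by blast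
  then have "rat_cnj rin' = rat_recip rout" by simp
  then show ?thesis by simp
qed

subsection \<open>Block matrices and joint injectivity\<close>

lemma mat_mult_cancel_left_inverse:
  fixes M :: "'a :: comm_ring_1 mat"
  assumes "K \<in> carrier_mat n n" and "M \<in> carrier_mat n n" and "N \<in> carrier_mat n k"
    and "K * M = 1\<^sub>m n"
  shows "K * (M * N) = N"
  using assms by (simp flip: assoc_mult_mat)

section \<open>The conjugate transpose\<close>

lemma mat_adjoint_altdef: "mat_adjoint M = map_mat conjugate (transpose_mat M)"
  unfolding mat_adjoint_def by (rule eq_matI) (auto simp: mat_of_rows_index)

lemma dim_mat_adjoint [simp]:
  "dim_row (mat_adjoint M) = dim_col M" "dim_col (mat_adjoint M) = dim_row M"
  by (simp_all add: mat_adjoint_altdef)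

lemma carrier_mat_adjoint [simp, intro]: "M \<in> carrier_mat nr nc \<Longrightarrow> mat_adjoint M \<in> carrier_mat nc nr"
  by (simp add: mat_adjoint_altdef)

lemma index_mat_adjoint [simp]:
  "i < dim_col M \<Longrightarrow> j < dim_row M \<Longrightarrow> mat_adjoint M $$ (i, j) = conjugate (M $$ (j, i))"
  by (simp add: mat_adjoint_altdef)

lemma transpose_mat_adjoint_mult_vec:
  fixes M :: "complex mat"
  assumes "M \<in> carrier_mat nr nc" and "v \<in> carrier_vec nc"
  shows "transpose_mat (mat_adjoint M) *\<^sub>v v = conjugate (M *\<^sub>v conjugate v)"
  using assms by (intro eq_vecI) (auto simp: scalar_prod_def)

lemma det_mat_adjoint:
  fixes M :: "complex mat"
  assumes "M \<in> carrier_mat n n"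
  shows "det (mat_adjoint M) = cnj (det M)"
proof -
  interpret comm_ring_hom cnj by standard auto
  have "mat_adjoint M = map_mat cnj (transpose_mat M)" by (simp add: mat_adjoint_altdef)
  then show ?thesis using assms by (simp add: det_transpose)
qed

lemma conjugate_vec_eq_0_iff:
  "(v :: complex vec) \<in> carrier_vec n \<Longrightarrow> conjugate v = 0\<^sub>v n \<longleftrightarrow> v = 0\<^sub>v n"
  by (auto simp: vec_eq_iff)

text \<open>Trivial joint kernel, that is, full column rank of the stacked matrix without forming
  it. Keeping the two blocks apart allows them to be scaled, conjugated and transposed
  separately.\<close>

definition inj_pair :: "complex mat \<Rightarrow> complex mat \<Rightarrow> bool" where
  "inj_pair X Y \<longleftrightarrow> (\<forall>v \<in> carrier_vec (dim_col X).
     X *\<^sub>v v = 0\<^sub>v (dim_row X) \<longrightarrow> Y *\<^sub>v v = 0\<^sub>v (dim_row Y) \<longrightarrow> v = 0\<^sub>v (dim_col X))"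

lemma inj_pair_iff:
  assumes "X \<in> carrier_mat a n" and "Y \<in> carrier_mat b n"
  shows "inj_pair X Y \<longleftrightarrow>
    (\<forall>v \<in> carrier_vec n. X *\<^sub>v v = 0\<^sub>v a \<longrightarrow> Y *\<^sub>v v = 0\<^sub>v b \<longrightarrow> v = 0\<^sub>v n)"
  using assms by (auto simp: inj_pair_def)

lemma full_col_rank_append_rows:
  assumes X: "X \<in> carrier_mat a n" and Y: "Y \<in> carrier_mat b n"
  shows "full_col_rank (X @\<^sub>r Y) \<longleftrightarrow> inj_pair X Y"
proof -
  have XY: "X @\<^sub>r Y \<in> carrier_mat (a + b) n" using assms by simp
  have "(X @\<^sub>r Y) *\<^sub>v v = 0\<^sub>v (a + b) \<longleftrightarrow> X *\<^sub>v v = 0\<^sub>v a \<and> Y *\<^sub>v v = 0\<^sub>v b" if "v \<in> carrier_vec n" for v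
  proof -
    have "0\<^sub>v (a + b) = 0\<^sub>v a @\<^sub>v (0\<^sub>v b :: complex vec)" by auto
    then show ?thesis unfolding mat_mult_append[OF X Y that]
      by simp (rule append_vec_eq[where n = a]; use X that in auto)
  qed
  then show ?thesis unfolding full_col_rank_iff[OF XY] inj_pair_def using X Y by auto
qed

lemma transpose_append_cols:
  assumes "X \<in> carrier_mat n a" and "Y \<in> carrier_mat n b"
  shows "transpose_mat (X @\<^sub>c Y) = transpose_mat X @\<^sub>r transpose_mat Y"
  using assms by (intro eq_matI) (auto simp: append_cols_def append_rows_def)

lemma transpose_append_rows:
  assumes "X \<in> carrier_mat a n" and "Y \<in> carrier_mat b n"
  shows "transpose_mat (X @\<^sub>r Y) = transpose_mat X @\<^sub>c transpose_mat Y"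
  using assms by (intro eq_matI) (auto simp: append_cols_def append_rows_def)

lemma carrier_append_cols [simp, intro]:
  "X \<in> carrier_mat n a \<Longrightarrow> Y \<in> carrier_mat n b \<Longrightarrow> X @\<^sub>c Y \<in> carrier_mat n (a + b)"
  by (auto simp: append_cols_def)

lemma full_row_rank_append_cols:
  assumes X: "X \<in> carrier_mat n a" and Y: "Y \<in> carrier_mat n b"
  shows "full_row_rank (X @\<^sub>c Y) \<longleftrightarrow> inj_pair (transpose_mat X) (transpose_mat Y)"
proof -
  have XY: "X @\<^sub>c Y \<in> carrier_mat n (a + b)" using assms by simp
  have "full_row_rank (X @\<^sub>c Y) \<longleftrightarrow> full_col_rank (transpose_mat (X @\<^sub>c Y))"
    using XY by (simp add: full_row_rank_iff[OF XY] full_col_rank_iff[of _ "a + b" n])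
  also have "\<dots> \<longleftrightarrow> inj_pair (transpose_mat X) (transpose_mat Y)"
    unfolding transpose_append_cols[OF X Y]
    by (rule full_col_rank_append_rows) (use X Y in auto)
  finally show ?thesis .
qed

text \<open>A Bezout identity with constant coefficients, read off from the column blocks of a left
  inverse of the stacked matrix.\<close>

lemma inj_pair_left_inverse:
  assumes X: "X \<in> carrier_mat a n" and Y: "Y \<in> carrier_mat b n" and inj: "inj_pair X Y"
  obtains V W where "V \<in> carrier_mat n a" "W \<in> carrier_mat n b" "V * X + W * Y = 1\<^sub>m n"
proof -
  have XY: "X @\<^sub>r Y \<in> carrier_mat (a + b) n" using X Y by simp
  have "full_col_rank (X @\<^sub>r Y)" using full_col_rank_append_rows[OF X Y] inj by simp
  then obtain U where U: "U \<in> carrier_mat n (a + b)" "U * (X @\<^sub>r Y) = 1\<^sub>m n"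
    using left_inverse_if_injective[OF XY] full_col_rank_iff[OF XY] by blast
  obtain V W E F where sb: "split_block U n a = (V, W, E, F)" by (cases "split_block U n a") auto
  \<comment> \<open>The rows are split as \<open>n + 0\<close>, so the lower blocks \<open>E\<close>
    and \<open>F\<close> are empty and only \<open>V\<close> and \<open>W\<close> carry
    content.\<close>
  note sb = split_block[OF sb, of 0 b]
  have VW: "V \<in> carrier_mat n a" "W \<in> carrier_mat n b" "E \<in> carrier_mat 0 a" "F \<in> carrier_mat 0 b"
    "U = four_block_mat V W E F" using sb U by auto
  have "U * (X @\<^sub>r Y) = four_block_mat (V * X + W * Y) (V * 0\<^sub>m a 0 + W * 0\<^sub>m b 0)
      (E * X + F * Y) (E * 0\<^sub>m a 0 + F * 0\<^sub>m b 0)"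
    unfolding VW(5) append_rows_def using X Y VW by (subst mult_four_block_mat) auto
  also have "\<dots> = V * X + W * Y" using X Y VW by (intro eq_matI) auto
  finally show ?thesis using that U VW by simp
qed

lemma det_nonzero_mult_vec_eq_0:
  fixes M :: "complex mat"
  assumes "M \<in> carrier_mat n n" and "det M \<noteq> 0" and "v \<in> carrier_vec n" and "M *\<^sub>v v = 0\<^sub>v n"
  shows "v = 0\<^sub>v n"
  using det_0_iff_vec_prod_zero_field[OF assms(1)] assms by blast

lemma zero_mat_mult_vec [simp]:
  "v \<in> carrier_vec nc \<Longrightarrow> 0\<^sub>m nr nc *\<^sub>v v = (0\<^sub>v nr :: 'a :: semiring_0 vec)"
  by (intro eq_vecI) (auto simp: scalar_prod_def)

lemma mult_mat_zero_vec:
  "M \<in> carrier_mat nr nc \<Longrightarrow> M *\<^sub>v 0\<^sub>v nc = (0\<^sub>v nr :: 'a :: semiring_0 vec)"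
  by (intro eq_vecI) (auto simp: scalar_prod_def)

text \<open>The big block sends \<open>(v1, v2, v3)\<close> to \<open>(P v2, Q v1, S v3)\<close>.
  Because \<open>P\<close> and \<open>Q\<close> stand off the diagonal, \<open>P\<close> is paired
  with \<open>F\<close> and \<open>Q\<close> with \<open>E\<close>. Each alternative kills two
  components by determinants and the third by the joint kernel condition.\<close>

lemma inj_pair_block:
  assumes P: "P \<in> carrier_mat n n" and Q: "Q \<in> carrier_mat n n" and S: "S \<in> carrier_mat p p"
    and E: "E \<in> carrier_mat m n" and F: "F \<in> carrier_mat m n" and G: "G \<in> carrier_mat m p"
    and cases: "det Q \<noteq> 0 \<and> det S \<noteq> 0 \<and> inj_pair P F \<or> det P \<noteq> 0 \<and> det S \<noteq> 0 \<and> inj_pair Q E \<or>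
      det P \<noteq> 0 \<and> det Q \<noteq> 0 \<and> inj_pair S G"
  shows "inj_pair (four_block_mat (four_block_mat (0\<^sub>m n n) P Q (0\<^sub>m n n)) (0\<^sub>m (n + n) p) (0\<^sub>m p (n + n)) S)
    (E @\<^sub>c F @\<^sub>c G)" (is "inj_pair ?X ?Y")
proof -
  let ?PQ = "four_block_mat (0\<^sub>m n n) P Q (0\<^sub>m n n)"
  have PQ: "?PQ \<in> carrier_mat (n + n) (n + n)" using P Q by auto
  have X: "?X \<in> carrier_mat (n + n + p) (n + n + p)" using PQ S by auto
  have Y: "?Y \<in> carrier_mat m (n + n + p)" using carrier_append_cols[OF E carrier_append_cols[OF F G]] by (simp add: add.assoc)
  have "v = 0\<^sub>v (n + n + p)" if v: "v \<in> carrier_vec (n + n + p)"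
    and Xv: "?X *\<^sub>v v = 0\<^sub>v (n + n + p)" and Yv: "?Y *\<^sub>v v = 0\<^sub>v m" for v
  proof -
    define v12 where "v12 = vec_first v (n + n)"
    define v1 where "v1 = vec_first v12 n"
    define v2 where "v2 = vec_last v12 n"
    define v3 where "v3 = vec_last v p"
    have c: "v1 \<in> carrier_vec n" "v2 \<in> carrier_vec n" "v3 \<in> carrier_vec p" "v12 \<in> carrier_vec (n + n)"
      by (simp_all add: v1_def v2_def v3_def v12_def)
    have v12: "v12 = v1 @\<^sub>v v2" unfolding v1_def v2_def
      by (rule vec_first_last_append[symmetric]) (rule c(4))
    have v: "v = v12 @\<^sub>v v3" unfolding v12_def v3_def
      by (rule vec_first_last_append[symmetric]) (rule that(1))
    have "?PQ *\<^sub>v v12 = (0\<^sub>m n n *\<^sub>v v1 + P *\<^sub>v v2) @\<^sub>v (Q *\<^sub>v v1 + 0\<^sub>m n n *\<^sub>v v2)"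
      unfolding v12 by (rule four_block_mat_mult_vec) (use P Q c in auto)
    also have "\<dots> = P *\<^sub>v v2 @\<^sub>v Q *\<^sub>v v1" using P Q c by simp
    finally have PQv: "?PQ *\<^sub>v v12 = P *\<^sub>v v2 @\<^sub>v Q *\<^sub>v v1" .
    have "?X *\<^sub>v v = (?PQ *\<^sub>v v12 + 0\<^sub>m (n + n) p *\<^sub>v v3) @\<^sub>v (0\<^sub>m p (n + n) *\<^sub>v v12 + S *\<^sub>v v3)"
      unfolding v by (rule four_block_mat_mult_vec) (use PQ S c in auto)
    also have "\<dots> = (P *\<^sub>v v2 @\<^sub>v Q *\<^sub>v v1) @\<^sub>v S *\<^sub>v v3" using P Q S c PQ PQv by simp
    also have "?X *\<^sub>v v = (0\<^sub>v n @\<^sub>v 0\<^sub>v n) @\<^sub>v 0\<^sub>v p" using Xv by auto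
    finally have "(P *\<^sub>v v2 @\<^sub>v Q *\<^sub>v v1) @\<^sub>v S *\<^sub>v v3 = (0\<^sub>v n @\<^sub>v 0\<^sub>v n) @\<^sub>v 0\<^sub>v p" by simp
    then have 1: "P *\<^sub>v v2 = 0\<^sub>v n" "Q *\<^sub>v v1 = 0\<^sub>v n" "S *\<^sub>v v3 = 0\<^sub>v p"
      using P Q S c by (auto simp: append_vec_eq[of _ "n + n"] append_vec_eq[of _ n])
    have dims: "dim_col E = n" "dim_col F = n" "dim_col G = p" "dim_col (F @\<^sub>c G) = n + p"
      using E F G by (auto simp: append_cols_def)
    have FG: "(F @\<^sub>c G) *\<^sub>v (v2 @\<^sub>v v3) = F *\<^sub>v v2 + G *\<^sub>v v3"
    proof -
      have "(F @\<^sub>c G) *\<^sub>v (v2 @\<^sub>v v3) = (F *\<^sub>v v2 + G *\<^sub>v v3) @\<^sub>v (0\<^sub>m 0 n *\<^sub>v v2 + 0\<^sub>m 0 p *\<^sub>v v3)"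
        unfolding append_cols_def dims by (rule four_block_mat_mult_vec) (use F G c in auto)
      then show ?thesis using F G c by (auto intro!: eq_vecI)
    qed
    have "?Y *\<^sub>v (v1 @\<^sub>v (v2 @\<^sub>v v3)) = (E *\<^sub>v v1 + (F @\<^sub>c G) *\<^sub>v (v2 @\<^sub>v v3)) @\<^sub>v (0\<^sub>m 0 n *\<^sub>v v1 + 0\<^sub>m 0 (n + p) *\<^sub>v (v2 @\<^sub>v v3))"
      unfolding append_cols_def[of E] dims by (rule four_block_mat_mult_vec) (use E F G c in auto)
    then have "?Y *\<^sub>v (v1 @\<^sub>v (v2 @\<^sub>v v3)) = E *\<^sub>v v1 + (F *\<^sub>v v2 + G *\<^sub>v v3)"
      using E F G c by (auto simp: FG intro!: eq_vecI)
    moreover have "v1 @\<^sub>v (v2 @\<^sub>v v3) = v" unfolding v v12 using c by (intro eq_vecI) auto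
    ultimately have 2: "E *\<^sub>v v1 + (F *\<^sub>v v2 + G *\<^sub>v v3) = 0\<^sub>v m" using Yv by simp
    have "v1 = 0\<^sub>v n \<and> v2 = 0\<^sub>v n \<and> v3 = 0\<^sub>v p"
      using cases
    proof (elim disjE conjE)
      assume d: "det Q \<noteq> 0" "det S \<noteq> 0" and "inj_pair P F"
      have "v1 = 0\<^sub>v n" "v3 = 0\<^sub>v p" using det_nonzero_mult_vec_eq_0 Q S d c 1 by blast+
      moreover from this have "F *\<^sub>v v2 = 0\<^sub>v m" using 2 E F G c by (simp add: mult_mat_zero_vec[OF E] mult_mat_zero_vec[OF F] mult_mat_zero_vec[OF G])
      ultimately show ?thesis using \<open>inj_pair P F\<close> c 1 by (simp add: inj_pair_iff[OF P F])
    next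
      assume d: "det P \<noteq> 0" "det S \<noteq> 0" and "inj_pair Q E"
      have "v2 = 0\<^sub>v n" "v3 = 0\<^sub>v p" using det_nonzero_mult_vec_eq_0 P S d c 1 by blast+
      moreover from this have "E *\<^sub>v v1 = 0\<^sub>v m" using 2 E F G c by (simp add: mult_mat_zero_vec[OF E] mult_mat_zero_vec[OF F] mult_mat_zero_vec[OF G])
      ultimately show ?thesis using \<open>inj_pair Q E\<close> c 1 by (simp add: inj_pair_iff[OF Q E])
    next
      assume d: "det P \<noteq> 0" "det Q \<noteq> 0" and "inj_pair S G"
      have "v1 = 0\<^sub>v n" "v2 = 0\<^sub>v n" using det_nonzero_mult_vec_eq_0 P Q d c 1 by blast+
      moreover from this have "G *\<^sub>v v3 = 0\<^sub>v m" using 2 E F G c by (simp add: mult_mat_zero_vec[OF E] mult_mat_zero_vec[OF F] mult_mat_zero_vec[OF G])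
      ultimately show ?thesis using \<open>inj_pair S G\<close> c 1 by (simp add: inj_pair_iff[OF S G])
    qed
    then show ?thesis unfolding v v12 by auto
  qed
  then show ?thesis unfolding inj_pair_iff[OF X Y] by blast
qed

subsection \<open>Nonsingularity away from the poles\<close>

lemma not_rat_pole_sum: "(\<And>i. i \<in> I \<Longrightarrow> \<not> rat_pole (f i) z) \<Longrightarrow> \<not> rat_pole (sum f I) z"
  using not_rat_pole_to_fract[of 0 z]
  by (induction I rule: infinite_finite_induct) (auto simp: not_rat_pole_add)

lemma not_rat_pole_prod: "(\<And>i. i \<in> I \<Longrightarrow> \<not> rat_pole (f i) z) \<Longrightarrow> \<not> rat_pole (prod f I) z"
  using not_rat_pole_to_fract[of 1 z]
  by (induction I rule: infinite_finite_induct) (auto simp: not_rat_pole_mult)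

lemma not_mat_poleD:
  "\<not> mat_pole M z \<Longrightarrow> i < dim_row M \<Longrightarrow> j < dim_col M \<Longrightarrow> \<not> rat_pole (M $$ (i, j)) z"
  by (auto simp: mat_pole_def)

lemma not_mat_pole_rat_mat [simp]: "\<not> mat_pole (rat_mat M) z"
  by (auto simp: mat_pole_def)

lemma not_mat_pole_add:
  assumes "\<not> mat_pole M z" and "\<not> mat_pole N z" and "M \<in> carrier_mat r c" and "N \<in> carrier_mat r c"
  shows "\<not> mat_pole (M + N) z"
  using assms by (auto simp: mat_pole_def not_rat_pole_add)

lemma not_mat_pole_diff:
  assumes "\<not> mat_pole M z" and "\<not> mat_pole N z" and "M \<in> carrier_mat r c" and "N \<in> carrier_mat r c"
  shows "\<not> mat_pole (M - N) z"
  using assms by (auto simp: mat_pole_def not_rat_pole_diff)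

lemma not_mat_pole_mult:
  assumes "\<not> mat_pole M z" and "\<not> mat_pole N z" and "M \<in> carrier_mat r n" and "N \<in> carrier_mat n c"
  shows "\<not> mat_pole (M * N) z"
proof -
  have "\<not> rat_pole ((M * N) $$ (i, j)) z" if "i < r" "j < c" for i j
  proof -
    have "\<not> rat_pole (\<Sum>l = 0..<n. M $$ (i, l) * N $$ (l, j)) z"
      using assms that by (intro not_rat_pole_sum not_rat_pole_mult) (auto simp: not_mat_poleD)
    then show ?thesis using assms that by (simp add: scalar_prod_def)
  qed
  then show ?thesis using assms by (auto simp: mat_pole_def)
qed

lemma not_mat_pole_smult:
  assumes "\<not> rat_pole r z" and "\<not> mat_pole M z"
  shows "\<not> mat_pole (r \<cdot>\<^sub>m M) z"
  using assms by (auto simp: mat_pole_def not_rat_pole_mult)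

lemma not_rat_pole_det:
  assumes "\<not> mat_pole M z" and M: "M \<in> carrier_mat n n"
  shows "\<not> rat_pole (det M) z"
proof -
  have "signof p = (to_fract (signof p) :: complex poly fract)" for p
    by (simp add: sign_def)
  then have "\<not> rat_pole (signof p) z" for p
    using not_rat_pole_to_fract by metis
  then show ?thesis unfolding det_def'[OF M]
    using assms by (intro not_rat_pole_sum not_rat_pole_mult not_rat_pole_prod not_mat_poleD) (auto simp: permutes_in_image)
qed

text \<open>A matrix with nonzero determinant is a unit of the matrix ring, so
  \<open>mat_inverse\<close> is not \<open>None\<close> and \<open>the\<close> selects a genuine
  inverse.\<close>

lemma rat_mat_inv:
  assumes M: "M \<in> carrier_mat n n" and "det M \<noteq> 0"
  shows "rat_mat_inv M \<in> carrier_mat n n" "M * rat_mat_inv M = 1\<^sub>m n" "rat_mat_inv M * M = 1\<^sub>m n"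
proof -
  have "M \<in> Units (ring_mat TYPE(complex poly fract) n b)" for b :: unit
    using det_non_zero_imp_unit[OF assms] by simp
  then obtain K where "mat_inverse M = Some K" using mat_inverse(1)[OF M] by fastforce
  then show "rat_mat_inv M \<in> carrier_mat n n" "M * rat_mat_inv M = 1\<^sub>m n" "rat_mat_inv M * M = 1\<^sub>m n"
    using mat_inverse(2)[OF M] by auto
qed

lemma det_nonzero_if_right_inverse:
  fixes M :: "'a :: idom mat"
  assumes "M \<in> carrier_mat n n" and "K \<in> carrier_mat n n" and "M * K = 1\<^sub>m n"
  shows "det M \<noteq> 0"
  using det_mult[OF assms(1,2)] assms(3) by auto

lemma rat_mat_inv_unique:
  assumes M: "M \<in> carrier_mat n n" and K: "K \<in> carrier_mat n n" and MK: "M * K = 1\<^sub>m n"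
  shows "rat_mat_inv M = K"
proof -
  note inv = rat_mat_inv[OF M det_nonzero_if_right_inverse[OF assms]]
  have "rat_mat_inv M = rat_mat_inv M * (M * K)" using MK inv by simp
  also have "\<dots> = K" by (rule mat_mult_cancel_left_inverse) (use M K inv in auto)
  finally show ?thesis .
qed

section \<open>Embedding and evaluation of polynomial matrices\<close>

lemma rat_mat_mult:
  assumes "M \<in> carrier_mat r n" and "N \<in> carrier_mat n c"
  shows "rat_mat (M * N) = rat_mat M * rat_mat N"
  using to_fract_hom.mat_hom_mult[OF assms] .

lemma rat_mat_add:
  assumes "M \<in> carrier_mat r c" and "N \<in> carrier_mat r c"
  shows "rat_mat (M + N) = rat_mat M + rat_mat N"
  using assms by (intro eq_matI) auto

lemma eval_mat_mult:
  assumes "M \<in> carrier_mat r n" and "N \<in> carrier_mat n c"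
  shows "eval_mat (M * N) z = eval_mat M z * eval_mat N z"
  unfolding eval_mat_def by (rule semiring_hom.mat_hom_mult[OF poly_hom.semiring_hom_axioms assms])

lemma eval_mat_add:
  assumes "M \<in> carrier_mat r c" and "N \<in> carrier_mat r c"
  shows "eval_mat (M + N) z = eval_mat M z + eval_mat N z"
  unfolding eval_mat_def using assms by (intro eq_matI) auto

lemma eval_mat_carrier [simp]: "eval_mat M z \<in> carrier_mat r c \<longleftrightarrow> M \<in> carrier_mat r c"
  by (simp add: eval_mat_def)

lemma eval_mat_const [simp]: "eval_mat (const_mat M) z = M"
  unfolding eval_mat_def by (intro eq_matI) auto

lemma eval_mat_uminus: "eval_mat (- M) z = - eval_mat M z"
  unfolding eval_mat_def by (intro eq_matI) auto

lemma det_eval_mat: "det (eval_mat M z) = poly (det M) z"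
  unfolding eval_mat_def by (rule comm_ring_hom.hom_det[OF poly_hom.comm_ring_hom_axioms])

text \<open>Minimality at \<open>z0\<close> provides constant matrices for which \<open>T = W A + V C\<close> and \<open>U = A X + B Y\<close>
  are the identity at \<open>z0\<close>. Since \<open>T A\<inverse> U\<close> is a polynomial expression in the blocks and
  in \<open>C A\<inverse> B = H - D\<close>, it has no pole at \<open>z0\<close>; comparing determinants, neither has \<open>1 / det A\<close>.\<close>

lemma regular_transfer_function_imp_nonsingular:
  assumes A: "A \<in> carrier_mat n n" and B: "B \<in> carrier_mat n m" and C: "C \<in> carrier_mat k n"
    and K: "K \<in> carrier_mat n n" "rat_mat A * K = 1\<^sub>m n" "K * rat_mat A = 1\<^sub>m n"
    and row: "inj_pair (transpose_mat (eval_mat (- A) z)) (transpose_mat (eval_mat B z))"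
    and col: "inj_pair (eval_mat (- A) z) (eval_mat C z)"
    and reg: "\<not> mat_pole (rat_mat C * K * rat_mat B) z"
  shows "det (eval_mat A z) \<noteq> 0"
proof -
  have Az: "eval_mat (- A) z \<in> carrier_mat n n" and Bz: "eval_mat B z \<in> carrier_mat n m"
    and Cz: "eval_mat C z \<in> carrier_mat k n" using A B C by auto
  \<comment> \<open>The row condition speaks of transposes, so the resulting identity is transposed
    back to one with the constant factors on the right.\<close>
  obtain X' Y' where X': "X' \<in> carrier_mat n n" and Y': "Y' \<in> carrier_mat n m"
    and "X' * transpose_mat (eval_mat (- A) z) + Y' * transpose_mat (eval_mat B z) = 1\<^sub>m n"
    using inj_pair_left_inverse[of "transpose_mat (eval_mat (- A) z)" n n "transpose_mat (eval_mat B z)" m]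
      Az Bz row by auto
  then have "transpose_mat (X' * transpose_mat (eval_mat (- A) z) + Y' * transpose_mat (eval_mat B z)) = 1\<^sub>m n"
    by simp
  also have "transpose_mat (X' * transpose_mat (eval_mat (- A) z) + Y' * transpose_mat (eval_mat B z)) =
      eval_mat (- A) z * transpose_mat X' + eval_mat B z * transpose_mat Y'"
    using Az Bz X' Y' by (subst transpose_add[of _ n n], simp_all add: transpose_mult[of _ n n _ n] transpose_mult[of _ n m _ n])
  finally have XY: "eval_mat (- A) z * transpose_mat X' + eval_mat B z * transpose_mat Y' = 1\<^sub>m n" .
  \<comment> \<open>The rank conditions concern \<open>- A\<close>. The sign is moved into
    \<open>X\<close>, and likewise into \<open>W\<close>, so that \<open>U\<close> and
    \<open>T\<close> are built from \<open>A\<close> itself.\<close>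
  define X where "X = - const_mat (transpose_mat X')"
  define Y where "Y = const_mat (transpose_mat Y')"
  define U where "U = A * X + B * Y"
  have X: "X \<in> carrier_mat n n" and Y: "Y \<in> carrier_mat m n" using X' Y' by (auto simp: X_def Y_def)
  have U: "U \<in> carrier_mat n n" using A B X Y by (auto simp: U_def)
  obtain W' V' where W': "W' \<in> carrier_mat n n" and V': "V' \<in> carrier_mat n k"
    and WV: "W' * eval_mat (- A) z + V' * eval_mat C z = 1\<^sub>m n"
    using inj_pair_left_inverse[OF Az Cz col] by blast
  define W where "W = - const_mat W'"
  define V where "V = const_mat V'"
  define T where "T = W * A + V * C"
  have W: "W \<in> carrier_mat n n" and V: "V \<in> carrier_mat n k" using W' V' by (auto simp: W_def V_def)
  have T: "T \<in> carrier_mat n n" using A C W V by (auto simp: T_def)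
  have "eval_mat U z = 1\<^sub>m n"
    using A B X Y X' XY unfolding U_def
    by (simp add: eval_mat_add[of _ n n] eval_mat_mult[of _ n n _ n] eval_mat_mult[of _ n m _ n]
        X_def Y_def eval_mat_uminus)
  then have U1: "poly (det U) z = 1" by (simp flip: det_eval_mat)
  have "eval_mat T z = 1\<^sub>m n"
    using A C W V W' WV unfolding T_def
    by (simp add: eval_mat_add[of _ n n] eval_mat_mult[of _ n n _ n] eval_mat_mult[of _ n k _ n]
        W_def V_def eval_mat_uminus)
  then have T1: "poly (det T) z = 1" by (simp flip: det_eval_mat)

  let ?r = rat_mat
  define G where "G = ?r C * K * ?r B"
  define P where "P = ?r T * K * ?r U"
  note cr = A B C X Y W V T U K(1)
  have G: "G \<in> carrier_mat k m" using cr by (auto simp: G_def)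
  have rU: "?r U = ?r A * ?r X + ?r B * ?r Y"
    using cr by (simp add: U_def rat_mat_add[of _ n n] rat_mat_mult[of _ n n _ n] rat_mat_mult[of _ n m _ n])
  have rT: "?r T = ?r W * ?r A + ?r V * ?r C"
    using cr by (simp add: T_def rat_mat_add[of _ n n] rat_mat_mult[of _ n n _ n] rat_mat_mult[of _ n k _ n])
  have "K * ?r U = K * (?r A * ?r X) + K * (?r B * ?r Y)"
    unfolding rU by (rule mult_add_distrib_mat) (use cr in auto)
  also have "K * (?r A * ?r X) = ?r X"
    by (rule mat_mult_cancel_left_inverse) (use cr K in auto)
  finally have KU: "K * ?r U = ?r X + K * (?r B * ?r Y)" .
  have "?r T * (K * (?r B * ?r Y)) = ?r W * ?r A * (K * (?r B * ?r Y)) + ?r V * ?r C * (K * (?r B * ?r Y))"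
    unfolding rT by (rule add_mult_distrib_mat) (use cr in auto)
  also have "?r W * ?r A * (K * (?r B * ?r Y)) = ?r W * (?r A * (K * (?r B * ?r Y)))"
    by (rule assoc_mult_mat) (use cr in auto)
  also have "?r A * (K * (?r B * ?r Y)) = ?r B * ?r Y"
    by (rule mat_mult_cancel_left_inverse) (use cr K in auto)
  also have "?r V * ?r C * (K * (?r B * ?r Y)) = ?r V * (?r C * (K * (?r B * ?r Y)))"
    by (rule assoc_mult_mat) (use cr in auto)
  also have "?r C * (K * (?r B * ?r Y)) = ?r C * K * (?r B * ?r Y)"
    by (rule assoc_mult_mat[symmetric]) (use cr in auto)
  also have "\<dots> = G * ?r Y" unfolding G_def
    by (rule assoc_mult_mat[symmetric]) (use cr in auto)
  finally have TKBY: "?r T * (K * (?r B * ?r Y)) = ?r W * (?r B * ?r Y) + ?r V * (G * ?r Y)" .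
  have "P = ?r T * (K * ?r U)" unfolding P_def by (rule assoc_mult_mat) (use cr in auto)
  also have "\<dots> = ?r T * ?r X + ?r T * (K * (?r B * ?r Y))"
    unfolding KU by (rule mult_add_distrib_mat) (use cr in auto)
  finally have P: "P = ?r T * ?r X + (?r W * (?r B * ?r Y) + ?r V * (G * ?r Y))"
    unfolding TKBY .
  have BY: "?r B * ?r Y \<in> carrier_mat n n" and GY: "G * ?r Y \<in> carrier_mat k n" using cr G by auto
  have "\<not> mat_pole (?r T * ?r X) z" by (rule not_mat_pole_mult) (use cr in auto)
  moreover have "\<not> mat_pole (?r W * (?r B * ?r Y)) z"
    by (intro not_mat_pole_mult[of _ _ _ n n n] not_mat_pole_mult[of _ _ _ n m n] not_mat_pole_rat_mat) (use cr in auto)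
  moreover have "\<not> mat_pole (?r V * (G * ?r Y)) z"
    by (intro not_mat_pole_mult[of _ _ _ n k n] not_mat_pole_mult[of _ _ _ k m n] not_mat_pole_rat_mat reg[folded G_def])
      (use cr G in auto)
  ultimately have "\<not> mat_pole P z" unfolding P
    by (intro not_mat_pole_add[of _ _ _ n n]) (use cr BY GY in auto)
  then have "\<not> rat_pole (det P) z" using cr by (intro not_rat_pole_det[of _ _ n]) (auto simp: P_def)
  then obtain a b where ab: "det P = to_fract a / to_fract b" "poly b z \<noteq> 0"
    unfolding not_rat_pole_iff by blast
  then have "b \<noteq> 0" by auto
  have "det K * to_fract (det A) = 1"
    using det_mult[of K n "?r A"] K cr by simp
  moreover have "det P = to_fract (det T) * det K * to_fract (det U)"
    unfolding P_def using cr by (simp add: det_mult[of _ n])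
  \<comment> \<open>Both \<open>det T\<close> and \<open>det U\<close> take the value
    \<open>1\<close> at \<open>z\<close>, so a zero of \<open>det A\<close> there could only be
    cancelled by a pole of \<open>det P\<close>.\<close>
  ultimately have "det P * to_fract (det A) = to_fract (det T * det U)" by (simp add: algebra_simps)
  then have "to_fract (a * det A) = to_fract (b * (det T * det U))"
    using ab \<open>b \<noteq> 0\<close> by (simp add: field_simps)
  then have "a * det A = b * (det T * det U)" by (simp only: to_fract_eq_iff)
  then have "poly a z * poly (det A) z = poly b z"
    using T1 U1 by (metis mult.right_neutral poly_mult)
  then show ?thesis using ab by (auto simp: det_eval_mat)
qed

subsection \<open>Palindromic pencils\<close>

lemma blk_four_block_mat:
  assumes "N \<in> carrier_mat n n" and "B \<in> carrier_mat n m" and "C \<in> carrier_mat k n" and "D \<in> carrier_mat k m"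
  shows "blk_A n (four_block_mat N B C D) = - N" "blk_B n (four_block_mat N B C D) = B"
    "blk_C n (four_block_mat N B C D) = C" "blk_D n (four_block_mat N B C D) = D"
  using assms
  by (auto simp: blk_A_def blk_B_def blk_C_def blk_D_def split_block_def Let_def intro!: eq_matI)

lemma pencil_iff:
  "pencil L \<longleftrightarrow> (\<forall>i < dim_row L. \<forall>j < dim_col L. degree (L $$ (i, j)) \<le> 1)"
proof
  assume "pencil L"
  then obtain L1 L0 where L1: "L1 \<in> carrier_mat (dim_row L) (dim_col L)"
    and L0: "L0 \<in> carrier_mat (dim_row L) (dim_col L)" and L: "L = Z \<cdot>\<^sub>m const_mat L1 + const_mat L0"
    unfolding pencil_def by blast
  have "L $$ (i, j) = [:L0 $$ (i, j), L1 $$ (i, j):]" if "i < dim_row L" "j < dim_col L" for i j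
    using L1 L0 that by (subst L) auto
  then show "\<forall>i < dim_row L. \<forall>j < dim_col L. degree (L $$ (i, j)) \<le> 1" by auto
next
  assume deg: "\<forall>i < dim_row L. \<forall>j < dim_col L. degree (L $$ (i, j)) \<le> 1"
  have "p = Z * [:coeff p 1:] + [:coeff p 0:]" if "degree p \<le> 1" for p :: "complex poly"
    using that by (cases p rule: pCons_cases) (auto simp: degree_pCons_eq_if split: if_splits elim!: degree_eq_zeroE)
  then have "L = Z \<cdot>\<^sub>m const_mat (lead_mat L) + const_mat (map_mat (\<lambda>p. coeff p 0) L)"
    using deg by (intro eq_matI) (auto simp: lead_mat_def)
  then show "pencil L" unfolding pencil_def
    by (intro exI[of _ "lead_mat L"] exI[of _ "map_mat (\<lambda>p. coeff p 0) L"]) (auto simp: lead_mat_def)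
qed

text \<open>Substituting \<open>1 / z\<close> and multiplying by \<open>z\<close> swaps the two
  coefficients of a linear polynomial, and the star conjugates them.\<close>

lemma rev_star_linear:
  assumes "degree p \<le> 1"
  shows "to_fract Z * rat_recip (rat_cnj (to_fract p)) = to_fract [:cnj (coeff p 1), cnj (coeff p 0):]"
proof -
  have p: "p = [:coeff p 0, coeff p 1:]"
    using assms by (cases p rule: pCons_cases) (auto simp: degree_pCons_eq_if split: if_splits elim!: degree_eq_zeroE)
  have "map_poly cnj p = [:cnj (coeff p 0), cnj (coeff p 1):]"
    by (subst p) (intro poly_eqI, simp add: coeff_map_poly coeff_pCons split: nat.split)
  then have "to_fract Z * rat_recip (rat_cnj (to_fract p)) =
      to_fract Z * (to_fract [:cnj (coeff p 0):] + 1 / to_fract Z * to_fract [:cnj (coeff p 1):])"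
    by (simp add: rat_cnj_to_fract rat_recip_to_fract poly_recip_pCons)
  also have "\<dots> = to_fract Z * to_fract [:cnj (coeff p 0):] + to_fract [:cnj (coeff p 1):]"
    by (simp add: distrib_left)
  also have "\<dots> = to_fract (Z * [:cnj (coeff p 0):] + [:cnj (coeff p 1):])"
    by (simp only: to_fract_hom.hom_mult to_fract_hom.hom_add)
  also have "Z * [:cnj (coeff p 0):] + [:cnj (coeff p 1):] = [:cnj (coeff p 1), cnj (coeff p 0):]" by simp
  finally show ?thesis .
qed

lemma star_palindromic_iff:
  assumes L: "L \<in> carrier_mat N N"
  shows "star_palindromic L \<longleftrightarrow> pencil L \<and>
    (\<forall>i < N. \<forall>j < N. coeff (L $$ (i, j)) 0 = cnj (coeff (L $$ (j, i)) 1))"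
proof (cases "pencil L")
  case True
  have deg: "degree (L $$ (i, j)) \<le> 1" if "i < N" "j < N" for i j
    using True L that by (simp add: pencil_iff)
  have lin: "p = [:a, b:] \<longleftrightarrow> coeff p 0 = a \<and> coeff p 1 = b" if "degree p \<le> 1" for p :: "complex poly" and a b
    using that by (cases p rule: pCons_cases) (auto simp: degree_pCons_eq_if split: if_splits elim!: degree_eq_zeroE)
  have rev: "to_fract Z * rat_recip (rat_cnj (to_fract p)) = to_fract q \<longleftrightarrow>
      q = [:cnj (coeff p 1), cnj (coeff p 0):]" if "degree p \<le> 1" for p q
    unfolding rev_star_linear[OF that] to_fract_eq_iff by (rule eq_commute)
  have "rev1 (rat_mat_star (rat_mat L)) = rat_mat L \<longleftrightarrow>
      (\<forall>i < N. \<forall>j < N. to_fract Z * rat_recip (rat_cnj (to_fract (L $$ (j, i)))) = to_fract (L $$ (i, j)))"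
    using L by (auto simp: rev1_def rat_mat_recip_def rat_mat_star_def mat_eq_iff)
  also have "\<dots> \<longleftrightarrow> (\<forall>i < N. \<forall>j < N. L $$ (i, j) = [:cnj (coeff (L $$ (j, i)) 1), cnj (coeff (L $$ (j, i)) 0):])"
    by (intro iff_allI imp_cong refl rev deg)
  also have "\<dots> \<longleftrightarrow> (\<forall>i < N. \<forall>j < N. coeff (L $$ (i, j)) 0 = cnj (coeff (L $$ (j, i)) 1) \<and>
      coeff (L $$ (i, j)) 1 = cnj (coeff (L $$ (j, i)) 0))"
    by (intro iff_allI imp_cong refl lin deg)
  \<comment> \<open>Exchanging \<open>i\<close> and \<open>j\<close> and conjugating turns each of
    the two coefficient conditions into the other.\<close>
  also have "\<dots> \<longleftrightarrow> (\<forall>i < N. \<forall>j < N. coeff (L $$ (i, j)) 0 = cnj (coeff (L $$ (j, i)) 1))"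
  proof (intro iffI allI impI conjI)
    fix i j assume "\<forall>i < N. \<forall>j < N. coeff (L $$ (i, j)) 0 = cnj (coeff (L $$ (j, i)) 1)" and "i < N" "j < N"
    then have "coeff (L $$ (j, i)) 0 = cnj (coeff (L $$ (i, j)) 1)" by blast
    then show "coeff (L $$ (i, j)) 1 = cnj (coeff (L $$ (j, i)) 0)" by simp
  qed blast+
  finally have "rev1 (rat_mat_star (rat_mat L)) = rat_mat L \<longleftrightarrow>
      (\<forall>i < N. \<forall>j < N. coeff (L $$ (i, j)) 0 = cnj (coeff (L $$ (j, i)) 1))" .
  moreover have "square_mat L" using L by simp
  ultimately show ?thesis using True unfolding star_palindromic_def by blast
qed (simp add: star_palindromic_def)

text \<open>The transpose of the adjoint is the entrywise conjugate, and conjugating vectors carries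
  its kernel to the original one.\<close>

lemma inj_pair_transpose_adjoint:
  assumes X: "X \<in> carrier_mat a n" and Y: "Y \<in> carrier_mat b n" and "inj_pair X Y"
  shows "inj_pair (transpose_mat (mat_adjoint X)) (transpose_mat (mat_adjoint Y))"
proof -
  have c: "transpose_mat (mat_adjoint X) \<in> carrier_mat a n" "transpose_mat (mat_adjoint Y) \<in> carrier_mat b n"
    using X Y by auto
  show ?thesis unfolding inj_pair_iff[OF c]
  proof (intro ballI impI)
    fix v :: "complex vec" assume v: "v \<in> carrier_vec n"
      and "transpose_mat (mat_adjoint X) *\<^sub>v v = 0\<^sub>v a" "transpose_mat (mat_adjoint Y) *\<^sub>v v = 0\<^sub>v b"
    then have "X *\<^sub>v conjugate v = 0\<^sub>v a" "Y *\<^sub>v conjugate v = 0\<^sub>v b"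
      using X Y conjugate_vec_eq_0_iff[of "X *\<^sub>v conjugate v" a] conjugate_vec_eq_0_iff[of "Y *\<^sub>v conjugate v" b]
      by (auto simp: transpose_mat_adjoint_mult_vec)
    moreover have "conjugate v \<in> carrier_vec n" using v by simp
    ultimately have "conjugate v = 0\<^sub>v n" using assms(3) unfolding inj_pair_iff[OF X Y] by blast
    then show "v = 0\<^sub>v n" using conjugate_vec_eq_0_iff[OF v] by simp
  qed
qed

lemma inj_pair_adjoint:
  assumes X: "X \<in> carrier_mat n a" and Y: "Y \<in> carrier_mat n b"
    and "inj_pair (transpose_mat X) (transpose_mat Y)"
  shows "inj_pair (mat_adjoint X) (mat_adjoint Y)"
proof -
  have "transpose_mat (mat_adjoint (transpose_mat M)) = mat_adjoint M" for M :: "complex mat"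
    by (intro eq_matI) auto
  then show ?thesis
    using inj_pair_transpose_adjoint[of "transpose_mat X" a n "transpose_mat Y" b] assms by simp
qed

lemma minimal_lsm_iff:
  assumes L: "L \<in> carrier_mat (n + k) (n + m)"
  shows "minimal_lsm n L \<longleftrightarrow> linear_system_matrix n L \<and>
    (\<forall>z. inj_pair (transpose_mat (eval_mat (- blk_A n L) z)) (transpose_mat (eval_mat (blk_B n L) z)) \<and>
         inj_pair (eval_mat (- blk_A n L) z) (eval_mat (blk_C n L) z))"
proof -
  have c: "- blk_A n L \<in> carrier_mat n n" "blk_B n L \<in> carrier_mat n m" "blk_C n L \<in> carrier_mat k n"
    using L by (auto simp: blk_A_def blk_B_def blk_C_def split_block_def Let_def)
  have "full_row_rank (eval_mat (- blk_A n L) z @\<^sub>c eval_mat (blk_B n L) z) \<longleftrightarrow>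
      inj_pair (transpose_mat (eval_mat (- blk_A n L) z)) (transpose_mat (eval_mat (blk_B n L) z))" for z
    by (rule full_row_rank_append_cols) (use c in auto)
  moreover have "full_col_rank (eval_mat (- blk_A n L) z @\<^sub>r eval_mat (blk_C n L) z) \<longleftrightarrow>
      inj_pair (eval_mat (- blk_A n L) z) (eval_mat (blk_C n L) z)" for z
    by (rule full_col_rank_append_rows) (use c in auto)
  ultimately show ?thesis by (simp add: minimal_lsm_def)
qed

text \<open>For a \<open>*\<close>-palindromic pencil \<open>z L1 + L0\<close> one has \<open>L1 = L0\<^sup>*\<close>, so the conditions at infinity are the
  adjoints of those at \<open>0\<close>.\<close>

lemma star_palindromic_minimal_at_infinity:
  assumes L: "L \<in> carrier_mat (n + m) (n + m)" and pal: "star_palindromic L" and min: "minimal_lsm n L"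
  shows "minimal_at_infinity n L"
proof -
  let ?A = "- blk_A n L" and ?B = "blk_B n L" and ?C = "blk_C n L"
  have c: "?A \<in> carrier_mat n n" "?B \<in> carrier_mat n m" "?C \<in> carrier_mat m n"
    using L by (auto simp: blk_A_def blk_B_def blk_C_def split_block_def Let_def)
  have lead: "coeff (L $$ (i, j)) 1 = cnj (coeff (L $$ (j, i)) 0)" if "i < n + m" "j < n + m" for i j
    using pal that by (simp add: star_palindromic_iff[OF L])
  have entries: "?A $$ (i, j) = L $$ (i, j)" if "i < n" "j < n" for i j
    using that L by (simp add: blk_A_def split_block_def Let_def)
  have entriesB: "?B $$ (i, j) = L $$ (i, j + n)" if "i < n" "j < m" for i j
    using that L by (simp add: blk_B_def split_block_def Let_def)
  have entriesC: "?C $$ (i, j) = L $$ (i + n, j)" if "i < m" "j < n" for i j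
    using that L by (simp add: blk_C_def split_block_def Let_def)
  \<comment> \<open>The blocks \<open>?B\<close> and \<open>?C\<close> change places, so the row
    condition at infinity comes from the column condition at \<open>0\<close>, and vice
    versa.\<close>
  have lead_eqs: "lead_mat ?A = mat_adjoint (eval_mat ?A 0)" "lead_mat ?B = mat_adjoint (eval_mat ?C 0)"
    "lead_mat ?C = mat_adjoint (eval_mat ?B 0)"
    using c by (auto intro!: eq_matI simp: lead_mat_def eval_mat_def entries entriesB entriesC lead[unfolded One_nat_def] poly_0_coeff_0 simp del: index_uminus_mat)
  have inj: "inj_pair (transpose_mat (eval_mat ?A 0)) (transpose_mat (eval_mat ?B 0))"
    "inj_pair (eval_mat ?A 0) (eval_mat ?C 0)"
    using min L by (auto simp: minimal_lsm_iff)
  have "full_row_rank (lead_mat ?A @\<^sub>c lead_mat ?B)"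
    using full_row_rank_append_cols[of "lead_mat ?A" n n "lead_mat ?B" m]
      inj_pair_transpose_adjoint[OF _ _ inj(2)] c by (simp add: lead_eqs)
  moreover have "full_col_rank (lead_mat ?A @\<^sub>r lead_mat ?C)"
    using full_col_rank_append_rows[of "lead_mat ?A" n n "lead_mat ?C" m]
      inj_pair_adjoint[OF _ _ inj(1)] c by (simp add: lead_eqs)
  ultimately show ?thesis using min by (simp add: minimal_at_infinity_def minimal_lsm_def)
qed

section \<open>Adjoints, products and inverses of block matrices\<close>

lemma map_append_cols:
  assumes "X \<in> carrier_mat n a" and "Y \<in> carrier_mat n b"
  shows "map_mat f (X @\<^sub>c Y) = map_mat f X @\<^sub>c map_mat f Y"
  using assms by (intro eq_matI) (auto simp: append_cols_def)

lemma map_append_rows: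
  assumes "X \<in> carrier_mat a n" and "Y \<in> carrier_mat b n"
  shows "map_mat f (X @\<^sub>r Y) = map_mat f X @\<^sub>r map_mat f Y"
  using assms by (intro eq_matI) (auto simp: append_rows_def)

lemma mat_adjoint_four_block_mat:
  assumes "A \<in> carrier_mat a c" and "B \<in> carrier_mat a d" and "C \<in> carrier_mat b c" and "D \<in> carrier_mat b d"
  shows "mat_adjoint (four_block_mat A B C D) =
    four_block_mat (mat_adjoint A) (mat_adjoint C) (mat_adjoint B) (mat_adjoint D)"
  using assms by (intro eq_matI) auto

lemma mat_adjoint_append_cols:
  assumes "X \<in> carrier_mat n a" and "Y \<in> carrier_mat n b"
  shows "mat_adjoint (X @\<^sub>c Y) = mat_adjoint X @\<^sub>r mat_adjoint Y"
  using assms by (intro eq_matI) (auto simp: append_cols_def append_rows_def)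

lemma mat_adjoint_append_rows:
  assumes "X \<in> carrier_mat a n" and "Y \<in> carrier_mat b n"
  shows "mat_adjoint (X @\<^sub>r Y) = mat_adjoint X @\<^sub>c mat_adjoint Y"
  using assms by (intro eq_matI) (auto simp: append_cols_def append_rows_def)

lemma mat_adjoint_zero [simp]: "mat_adjoint (0\<^sub>m a b :: complex mat) = 0\<^sub>m b a"
  by (intro eq_matI) auto

lemma append_cols_assoc:
  assumes "X \<in> carrier_mat n a" and "Y \<in> carrier_mat n b" and "W \<in> carrier_mat n c"
  shows "X @\<^sub>c Y @\<^sub>c W = (X @\<^sub>c Y) @\<^sub>c W"
  using assms by (intro eq_matI) (auto simp: append_cols_def)

lemma append_cols_mult_four_block_mat:
  assumes "X \<in> carrier_mat r a" "Y \<in> carrier_mat r b"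
    and "P \<in> carrier_mat a c" "Q \<in> carrier_mat a d" "R \<in> carrier_mat b c" "S \<in> carrier_mat b d"
  shows "(X @\<^sub>c Y) * four_block_mat P Q R S = (X * P + Y * R) @\<^sub>c (X * Q + Y * S)"
proof -
  have dims: "dim_col X = a" "dim_col Y = b" using assms by auto
  have "(X @\<^sub>c Y) * four_block_mat P Q R S =
      four_block_mat (X * P + Y * R) (X * Q + Y * S) (0\<^sub>m 0 a * P + 0\<^sub>m 0 b * R) (0\<^sub>m 0 a * Q + 0\<^sub>m 0 b * S)"
    unfolding append_cols_def dims by (rule mult_four_block_mat) (use assms in auto)
  moreover have "0\<^sub>m 0 a * P + 0\<^sub>m 0 b * R = 0\<^sub>m 0 c" "0\<^sub>m 0 a * Q + 0\<^sub>m 0 b * S = 0\<^sub>m 0 d"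
    using assms by (auto intro!: eq_matI)
  moreover have "dim_col (X * P + Y * R) = c" "dim_col (X * Q + Y * S) = d" using assms by auto
  ultimately show ?thesis by (simp only: append_cols_def[of "X * P + Y * R"])
qed

lemma append_cols_mult_append_rows:
  assumes "X \<in> carrier_mat r a" "Y \<in> carrier_mat r b" and "U \<in> carrier_mat a c" "V \<in> carrier_mat b c"
  shows "(X @\<^sub>c Y) * (U @\<^sub>r V) = X * U + Y * V"
proof -
  have "(X @\<^sub>c Y) * (U @\<^sub>r V) = (X * U + Y * V) @\<^sub>c (X * 0\<^sub>m a 0 + Y * 0\<^sub>m b 0)"
    unfolding append_rows_def using assms by (subst append_cols_mult_four_block_mat) auto
  then show ?thesis using assms by (auto simp: append_cols_def intro!: eq_matI)
qed

text \<open>Inverting the antidiagonal block also exchanges the places of its entries: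
  \<open>Ni\<close> stands where \<open>M\<close> stood.\<close>

lemma block_inverse:
  fixes M :: "'a :: comm_ring_1 mat"
  assumes "M \<in> carrier_mat n n" "N \<in> carrier_mat n n" "S \<in> carrier_mat p p"
    and "Mi \<in> carrier_mat n n" "Ni \<in> carrier_mat n n" "Si \<in> carrier_mat p p"
    and "M * Mi = 1\<^sub>m n" "N * Ni = 1\<^sub>m n" "S * Si = 1\<^sub>m p"
  shows "four_block_mat (four_block_mat (0\<^sub>m n n) M N (0\<^sub>m n n)) (0\<^sub>m (n + n) p) (0\<^sub>m p (n + n)) S *
    four_block_mat (four_block_mat (0\<^sub>m n n) Ni Mi (0\<^sub>m n n)) (0\<^sub>m (n + n) p) (0\<^sub>m p (n + n)) Si = 1\<^sub>m (n + n + p)"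
proof -
  have "four_block_mat (0\<^sub>m n n) M N (0\<^sub>m n n) * four_block_mat (0\<^sub>m n n) Ni Mi (0\<^sub>m n n) = 1\<^sub>m (n + n)"
    using assms by (subst mult_four_block_mat[of _ n n _ n _ n _ _ n _ n]) auto
  then show ?thesis
    using assms by (subst mult_four_block_mat[of _ "n + n" "n + n" _ p _ p _ _ "n + n" _ p]) auto
qed

text \<open>Applied with \<open>M\<close>, \<open>N\<close> and \<open>S\<close> already inverted,
  this splits the transfer function into three uncoupled ones. The antidiagonal position crosses the
  pairing: \<open>F\<close> meets \<open>U\<close> and \<open>E\<close> meets
  \<open>V\<close>.\<close>

lemma block_transfer:
  fixes E :: "'a :: comm_ring_1 mat"
  assumes E: "E \<in> carrier_mat r n" and F: "F \<in> carrier_mat r n" and G: "G \<in> carrier_mat r p"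
    and M: "M \<in> carrier_mat n n" and N: "N \<in> carrier_mat n n" and S: "S \<in> carrier_mat p p"
    and U: "U \<in> carrier_mat n c" and V: "V \<in> carrier_mat n c" and W: "W \<in> carrier_mat p c"
  shows "(E @\<^sub>c F @\<^sub>c G) * four_block_mat (four_block_mat (0\<^sub>m n n) N M (0\<^sub>m n n)) (0\<^sub>m (n + n) p) (0\<^sub>m p (n + n)) S *
      (U @\<^sub>r V @\<^sub>r W) = F * M * U + E * N * V + G * S * W"
proof -
  let ?K = "four_block_mat (0\<^sub>m n n) N M (0\<^sub>m n n)"
  have EF: "E @\<^sub>c F \<in> carrier_mat r (n + n)" and UV: "U @\<^sub>r V \<in> carrier_mat (n + n) c"
    using E F U V by auto
  have K: "?K \<in> carrier_mat (n + n) (n + n)" using M N by auto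
  have EFK: "(E @\<^sub>c F) * ?K = (F * M) @\<^sub>c (E * N)"
    using E F M N by (subst append_cols_mult_four_block_mat[of _ r n _ n _ n _ n]) auto
  have FM: "F * M \<in> carrier_mat r n" and EN: "E * N \<in> carrier_mat r n" and GS: "G * S \<in> carrier_mat r p"
    using E F G M N S by auto
  have "(E @\<^sub>c F @\<^sub>c G) * four_block_mat ?K (0\<^sub>m (n + n) p) (0\<^sub>m p (n + n)) S = ((F * M) @\<^sub>c (E * N)) @\<^sub>c (G * S)"
  proof -
    have "((E @\<^sub>c F) @\<^sub>c G) * four_block_mat ?K (0\<^sub>m (n + n) p) (0\<^sub>m p (n + n)) S =
        ((E @\<^sub>c F) * ?K + G * 0\<^sub>m p (n + n)) @\<^sub>c ((E @\<^sub>c F) * 0\<^sub>m (n + n) p + G * S)"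
      by (rule append_cols_mult_four_block_mat) (use EF G K S in auto)
    also have "(E @\<^sub>c F) * ?K + G * 0\<^sub>m p (n + n) = (F * M) @\<^sub>c (E * N)"
      unfolding EFK using G carrier_append_cols[OF FM EN] by simp
    also have "(E @\<^sub>c F) * 0\<^sub>m (n + n) p + G * S = G * S" using EF GS by simp
    finally show ?thesis unfolding append_cols_assoc[OF E F G] .
  qed
  moreover have "((F * M) @\<^sub>c (E * N)) @\<^sub>c (G * S) = (F * M) @\<^sub>c (E * N) @\<^sub>c (G * S)"
    using append_cols_assoc[OF FM EN GS] by simp
  moreover have "((F * M) @\<^sub>c (E * N) @\<^sub>c (G * S)) * (U @\<^sub>r V @\<^sub>r W) =
      F * M * U + ((E * N) @\<^sub>c (G * S)) * (V @\<^sub>r W)"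
    by (rule append_cols_mult_append_rows[OF FM _ U]) (use EN GS V W in auto)
  moreover have "((E * N) @\<^sub>c (G * S)) * (V @\<^sub>r W) = E * N * V + G * S * W"
    by (rule append_cols_mult_append_rows[OF EN GS V W])
  moreover have "F * M * U + (E * N * V + G * S * W) = F * M * U + E * N * V + G * S * W"
    by (rule assoc_add_mat[symmetric]) (use FM EN GS U V W in auto)
  ultimately show ?thesis by simp
qed

lemma four_block_mat_inject:
  assumes "A \<in> carrier_mat a c" "B \<in> carrier_mat a d" "C \<in> carrier_mat b c" "D \<in> carrier_mat b d"
    and "A' \<in> carrier_mat a c" "B' \<in> carrier_mat a d" "C' \<in> carrier_mat b c" "D' \<in> carrier_mat b d"
    and eq: "four_block_mat A B C D = four_block_mat A' B' C' D'"
  shows "A = A'" "B = B'" "C = C'" "D = D'"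
proof -
  have *: "four_block_mat A B C D $$ (i, j) = four_block_mat A' B' C' D' $$ (i, j)" for i j
    using eq by simp
  show "A = A'" using assms(1-8) *[of i j for i j] by (intro eq_matI) (metis carrier_matD index_mat_four_block(1) trans_less_add1, auto)
  show "B = B'"
  proof (rule eq_matI)
    fix i j assume "i < dim_row B'" "j < dim_col B'"
    then show "B $$ (i, j) = B' $$ (i, j)" using assms(1-8) *[of i "j + c"] by simp
  qed (use assms in auto)
  show "C = C'"
  proof (rule eq_matI)
    fix i j assume "i < dim_row C'" "j < dim_col C'"
    then show "C $$ (i, j) = C' $$ (i, j)" using assms(1-8) *[of "i + a" j] by simp
  qed (use assms in auto)
  show "D = D'"
  proof (rule eq_matI)
    fix i j assume "i < dim_row D'" "j < dim_col D'"
    then show "D $$ (i, j) = D' $$ (i, j)" using assms(1-8) *[of "i + a" "j + c"] by simp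
  qed (use assms in auto)
qed

section \<open>Degrees, values and leading coefficients of block pencils\<close>

lemma pencil_four_block_mat:
  assumes "A \<in> carrier_mat a c" "B \<in> carrier_mat a d" "C \<in> carrier_mat b c" "D \<in> carrier_mat b d"
  shows "pencil (four_block_mat A B C D) \<longleftrightarrow> pencil A \<and> pencil B \<and> pencil C \<and> pencil D"
proof
  assume "pencil (four_block_mat A B C D)"
  then have deg: "degree (four_block_mat A B C D $$ (i, j)) \<le> 1" if "i < a + b" "j < c + d" for i j
    using that assms by (simp add: pencil_iff)
  have "degree (A $$ (i, j)) \<le> 1" if "i < a" "j < c" for i j using deg[of i j] that assms by simp
  moreover have "degree (B $$ (i, j)) \<le> 1" if "i < a" "j < d" for i j using deg[of i "j + c"] that assms by simp
  moreover have "degree (C $$ (i, j)) \<le> 1" if "i < b" "j < c" for i j using deg[of "i + a" j] that assms by simp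
  moreover have "degree (D $$ (i, j)) \<le> 1" if "i < b" "j < d" for i j using deg[of "i + a" "j + c"] that assms by simp
  ultimately show "pencil A \<and> pencil B \<and> pencil C \<and> pencil D" using assms by (auto simp: pencil_iff)
next
  assume "pencil A \<and> pencil B \<and> pencil C \<and> pencil D"
  then show "pencil (four_block_mat A B C D)" using assms by (auto simp: pencil_iff)
qed

lemma pencil_zero [simp]: "pencil (0\<^sub>m a b)"
  by (simp add: pencil_iff)

lemma pencil_append_cols:
  assumes "X \<in> carrier_mat n a" and "Y \<in> carrier_mat n b"
  shows "pencil (X @\<^sub>c Y) \<longleftrightarrow> pencil X \<and> pencil Y"
  unfolding append_cols_def using assms by (subst pencil_four_block_mat[of _ n a _ b _ 0]) auto

lemma pencil_append_rows:
  assumes "X \<in> carrier_mat a n" and "Y \<in> carrier_mat b n"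
  shows "pencil (X @\<^sub>r Y) \<longleftrightarrow> pencil X \<and> pencil Y"
  unfolding append_rows_def using assms by (subst pencil_four_block_mat[of _ a n _ 0 _ b]) auto

text \<open>Evaluation at \<open>0\<close>, the leading coefficient and the adjoint all act
  blockwise, so in this form palindromicity of a block pencil is checked block by block.\<close>

lemma star_palindromic_iff_adjoint:
  assumes L: "L \<in> carrier_mat N N"
  shows "star_palindromic L \<longleftrightarrow> pencil L \<and> eval_mat L 0 = mat_adjoint (lead_mat L)"
proof -
  have "eval_mat L 0 = mat_adjoint (lead_mat L) \<longleftrightarrow>
      (\<forall>i < N. \<forall>j < N. coeff (L $$ (i, j)) 0 = cnj (coeff (L $$ (j, i)) 1))"
    using L by (auto simp: mat_eq_iff eval_mat_def lead_mat_def poly_0_coeff_0)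
  then show ?thesis unfolding star_palindromic_iff[OF L] by blast
qed

lemma lead_mat_carrier [simp]: "lead_mat M \<in> carrier_mat r c \<longleftrightarrow> M \<in> carrier_mat r c"
  by (simp add: lead_mat_def)

lemma eval_lead_zero [simp]: "eval_mat (0\<^sub>m a b) z = 0\<^sub>m a b" "lead_mat (0\<^sub>m a b) = 0\<^sub>m a b"
  by (auto simp: eval_mat_def lead_mat_def)

lemma eval_lead_four_block_mat:
  assumes "A \<in> carrier_mat a c" "B \<in> carrier_mat a d" "C \<in> carrier_mat b c" "D \<in> carrier_mat b d"
  shows "eval_mat (four_block_mat A B C D) z = four_block_mat (eval_mat A z) (eval_mat B z) (eval_mat C z) (eval_mat D z)"
    "lead_mat (four_block_mat A B C D) = four_block_mat (lead_mat A) (lead_mat B) (lead_mat C) (lead_mat D)"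
  unfolding eval_mat_def lead_mat_def by (rule map_four_block_mat[OF assms])+

lemma eval_lead_append_cols:
  assumes "X \<in> carrier_mat n a" and "Y \<in> carrier_mat n b"
  shows "eval_mat (X @\<^sub>c Y) z = eval_mat X z @\<^sub>c eval_mat Y z" "lead_mat (X @\<^sub>c Y) = lead_mat X @\<^sub>c lead_mat Y"
  unfolding eval_mat_def lead_mat_def by (rule map_append_cols[OF assms])+

lemma eval_lead_append_rows:
  assumes "X \<in> carrier_mat a n" and "Y \<in> carrier_mat b n"
  shows "eval_mat (X @\<^sub>r Y) z = eval_mat X z @\<^sub>r eval_mat Y z" "lead_mat (X @\<^sub>r Y) = lead_mat X @\<^sub>r lead_mat Y"
  unfolding eval_mat_def lead_mat_def by (rule map_append_rows[OF assms])+

subsection \<open>The inner and outer parts\<close>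

lemma invertible_mat_imp_det_nonzero:
  fixes A :: "'a :: idom mat"
  assumes A: "A \<in> carrier_mat n n" and "invertible_mat A"
  shows "det A \<noteq> 0"
proof -
  obtain B where "A * B = 1\<^sub>m n" "B * A = 1\<^sub>m (dim_row B)"
    using assms by (auto simp: invertible_mat_def inverts_mat_def)
  moreover from this have "B \<in> carrier_mat n n"
    using A by (metis carrier_matI carrier_matD(2) index_mult_mat(3) index_one_mat(3))
  ultimately show ?thesis using A det_nonzero_if_right_inverse by blast
qed

text \<open>The map \<open>rat_recip\<close> after \<open>rat_cnj\<close> is a ring homomorphism
  that conjugates constants and inverts \<open>z\<close>. With transposition it sends
  \<open>z A1 - A0\<close> to the reflected pencil divided by \<open>z\<close>; inverting this
  produces the factor \<open>z\<close>, and transposing reverses the order of \<open>B\<close> and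
  \<open>C\<close>.\<close>

lemma rat_mat_recip_cnj_realization:
  fixes A1 A0 B C :: "complex mat"
  assumes A1: "A1 \<in> carrier_mat n n" and A0: "A0 \<in> carrier_mat n n"
    and B: "B \<in> carrier_mat k n" and C: "C \<in> carrier_mat n m"
    and det: "det (rat_mat (Z \<cdot>\<^sub>m const_mat A1 - const_mat A0)) \<noteq> 0"
    and H: "H = rat_mat (const_mat B) * rat_mat_inv (rat_mat (Z \<cdot>\<^sub>m const_mat A1 - const_mat A0)) * rat_mat (const_mat C)"
    and det': "det (rat_mat (const_mat (mat_adjoint A1) - Z \<cdot>\<^sub>m const_mat (mat_adjoint A0))) \<noteq> 0"
  shows "transpose_mat (map_mat (\<lambda>r. rat_recip (rat_cnj r)) H) =
    to_fract Z \<cdot>\<^sub>m (rat_mat (const_mat (mat_adjoint C)) *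
      rat_mat_inv (rat_mat (const_mat (mat_adjoint A1) - Z \<cdot>\<^sub>m const_mat (mat_adjoint A0))) *
      rat_mat (const_mat (mat_adjoint B)))"
proof -
  define M where "M = rat_mat (Z \<cdot>\<^sub>m const_mat A1 - const_mat A0)"
  define Q where "Q = rat_mat (const_mat (mat_adjoint A1) - Z \<cdot>\<^sub>m const_mat (mat_adjoint A0))"
  define \<Phi> where "\<Phi> = (\<lambda>r. rat_recip (rat_cnj r))"
  have M: "M \<in> carrier_mat n n" and Q: "Q \<in> carrier_mat n n" using A1 A0 by (auto simp: M_def Q_def)
  note Mi = rat_mat_inv[OF M det[folded M_def]] and Qi = rat_mat_inv[OF Q det'[folded Q_def]]
  interpret \<Phi>: comm_ring_hom \<Phi>
    unfolding \<Phi>_def by standard (simp_all add: rat_recip.hom_add rat_cnj.hom_add rat_recip.hom_mult rat_cnj.hom_mult)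
  have const: "\<Phi> (to_fract [:c:]) = to_fract [:cnj c:]" for c
    by (simp add: \<Phi>_def rat_cnj_to_fract rat_recip_to_fract)
  have Z0: "to_fract Z \<noteq> (0 :: complex poly fract)" by simp
  have "map_poly cnj Z = Z" by (intro poly_eqI) (simp add: coeff_map_poly coeff_pCons split: nat.split)
  then have \<Phi>Z: "\<Phi> (to_fract Z) = 1 / to_fract Z"
    by (simp add: \<Phi>_def rat_cnj_to_fract rat_recip_to_fract)
  have \<Phi>M: "transpose_mat (map_mat \<Phi> M) = (1 / to_fract Z) \<cdot>\<^sub>m Q"
  proof (rule eq_matI)
    fix i j assume "i < dim_row ((1 / to_fract Z) \<cdot>\<^sub>m Q)" "j < dim_col ((1 / to_fract Z) \<cdot>\<^sub>m Q)"
    then have ij: "i < n" "j < n" using Q by auto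
    have "M $$ (j, i) = to_fract (Z * [:A1 $$ (j, i):] - [:A0 $$ (j, i):])"
      using ij A1 A0 unfolding M_def by simp
    then have "\<Phi> (M $$ (j, i)) = 1 / to_fract Z * to_fract [:cnj (A1 $$ (j, i)):] - to_fract [:cnj (A0 $$ (j, i)):]"
      by (simp only: to_fract_hom.hom_minus to_fract_hom.hom_mult \<Phi>.hom_minus \<Phi>.hom_mult const \<Phi>Z)
    also have "\<dots> = 1 / to_fract Z * (to_fract [:cnj (A1 $$ (j, i)):] - to_fract Z * to_fract [:cnj (A0 $$ (j, i)):])"
      using Z0 by (simp add: right_diff_distrib)
    also have "to_fract [:cnj (A1 $$ (j, i)):] - to_fract Z * to_fract [:cnj (A0 $$ (j, i)):] =
        to_fract ([:cnj (A1 $$ (j, i)):] - Z * [:cnj (A0 $$ (j, i)):])"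
      by (simp only: to_fract_hom.hom_minus to_fract_hom.hom_mult)
    also have "\<dots> = Q $$ (i, j)" using ij A1 A0 unfolding Q_def by simp
    finally show "transpose_mat (map_mat \<Phi> M) $$ (i, j) = ((1 / to_fract Z) \<cdot>\<^sub>m Q) $$ (i, j)"
      using ij M Q by simp
  qed (use M Q in auto)
  \<comment> \<open>The transformed inverse of \<open>M\<close> inverts the transformed
    \<open>M\<close>, which is \<open>Q\<close> divided by \<open>z\<close>; hence \<open>X\<close>
    is \<open>z\<close> times the inverse of \<open>Q\<close>.\<close>
  define X where "X = transpose_mat (map_mat \<Phi> (rat_mat_inv M))"
  have X: "X \<in> carrier_mat n n" using Mi by (simp add: X_def)
  have "map_mat \<Phi> (rat_mat_inv M) * map_mat \<Phi> M = 1\<^sub>m n"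
    using \<Phi>.mat_hom_mult[OF Mi(1) M] Mi(3) \<Phi>.mat_hom_one by simp
  then have "transpose_mat (map_mat \<Phi> (rat_mat_inv M) * map_mat \<Phi> M) = 1\<^sub>m n" by simp
  then have "(1 / to_fract Z) \<cdot>\<^sub>m Q * X = 1\<^sub>m n"
    using M Mi by (simp add: transpose_mult[of _ n n _ n] \<Phi>M X_def)
  then have "Q * ((1 / to_fract Z) \<cdot>\<^sub>m X) = 1\<^sub>m n"
    by (simp only: mult_smult_assoc_mat[OF Q X] mult_smult_distrib[OF Q X])
  then have "rat_mat_inv Q = (1 / to_fract Z) \<cdot>\<^sub>m X"
    using Q X by (intro rat_mat_inv_unique[of _ n]) auto
  then have XQ: "X = to_fract Z \<cdot>\<^sub>m rat_mat_inv Q"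
    using X by (intro eq_matI) auto
  have c: "rat_mat (const_mat B) \<in> carrier_mat k n" "rat_mat (const_mat C) \<in> carrier_mat n m" using B C by auto
  have tB: "transpose_mat (map_mat \<Phi> (rat_mat (const_mat B))) = rat_mat (const_mat (mat_adjoint B))"
    using B by (intro eq_matI) (auto simp: const)
  have tC: "transpose_mat (map_mat \<Phi> (rat_mat (const_mat C))) = rat_mat (const_mat (mat_adjoint C))"
    using C by (intro eq_matI) (auto simp: const)
  have "map_mat \<Phi> H = map_mat \<Phi> (rat_mat (const_mat B)) * map_mat \<Phi> (rat_mat_inv M) * map_mat \<Phi> (rat_mat (const_mat C))"
    unfolding H M_def[symmetric] using c Mi(1)
    by (subst \<Phi>.mat_hom_mult[of _ k n _ m], simp, simp) (subst \<Phi>.mat_hom_mult[of _ k n _ n], simp_all)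
  then have "transpose_mat (map_mat \<Phi> H) =
      transpose_mat (map_mat \<Phi> (rat_mat (const_mat C))) * (X * transpose_mat (map_mat \<Phi> (rat_mat (const_mat B))))"
    using c Mi(1) by (simp add: transpose_mult[of _ k n _ m] transpose_mult[of _ n n _ m] X_def)
  also have "\<dots> = rat_mat (const_mat (mat_adjoint C)) * (to_fract Z \<cdot>\<^sub>m rat_mat_inv Q * rat_mat (const_mat (mat_adjoint B)))"
    unfolding tB tC XQ ..
  also have "\<dots> = to_fract Z \<cdot>\<^sub>m (rat_mat (const_mat (mat_adjoint C)) * (rat_mat_inv Q * rat_mat (const_mat (mat_adjoint B))))"
    using Qi(1) B C by (simp add: mult_smult_distrib[of _ m n _ k] mult_smult_assoc_mat[of _ n n _ k])
  also have "rat_mat (const_mat (mat_adjoint C)) * (rat_mat_inv Q * rat_mat (const_mat (mat_adjoint B))) =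
      rat_mat (const_mat (mat_adjoint C)) * rat_mat_inv Q * rat_mat (const_mat (mat_adjoint B))"
    by (rule assoc_mult_mat[symmetric]) (use Qi(1) B C in auto)
  finally show ?thesis unfolding \<Phi>_def Q_def .
qed

lemma det_uminus_eq_0_iff:
  fixes M :: "'a :: idom mat"
  assumes "M \<in> carrier_mat n n"
  shows "det (- M) = 0 \<longleftrightarrow> det M = 0"
proof -
  have "- M = (- 1) \<cdot>\<^sub>m M" by (intro eq_matI) auto
  then show ?thesis by simp
qed

text \<open>Nonzero scalars leave kernels unchanged. This absorbs the factors \<open>z\<close> and
  \<open>1 + z\<close> at the points where they do not vanish.\<close>

lemma inj_pair_smult:
  assumes inj: "inj_pair X Y" and X: "X \<in> carrier_mat k n" and Y: "Y \<in> carrier_mat l n"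
    and "a \<noteq> 0" and "b \<noteq> 0"
  shows "inj_pair (a \<cdot>\<^sub>m X) (b \<cdot>\<^sub>m Y)"
proof -
  have 1: "(c \<cdot>\<^sub>m M) *\<^sub>v v = c \<cdot>\<^sub>v (M *\<^sub>v v)" if "v \<in> carrier_vec (dim_col M)" for c :: complex and M v
    using that by (intro eq_vecI) auto
  have 2: "w = 0\<^sub>v d" if "c \<cdot>\<^sub>v w = 0\<^sub>v d" "c \<noteq> 0" for c :: complex and w d
    using that by (auto simp: vec_eq_iff)
  have c: "a \<cdot>\<^sub>m X \<in> carrier_mat k n" "b \<cdot>\<^sub>m Y \<in> carrier_mat l n" using X Y by auto
  show ?thesis unfolding inj_pair_iff[OF c]
  proof (intro ballI impI)
    fix v assume "v \<in> carrier_vec n" "(a \<cdot>\<^sub>m X) *\<^sub>v v = 0\<^sub>v k" "(b \<cdot>\<^sub>m Y) *\<^sub>v v = 0\<^sub>v l"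
    then show "v = 0\<^sub>v n" using inj 2 assms(4,5) X Y unfolding inj_pair_iff[OF X Y] by (auto simp: 1)
  qed
qed

text \<open>Because of the transpose, the identity at \<open>(i, j)\<close> relates two different
  entries: the scalar lemma is used with the entry \<open>(j, i)\<close> in the primed role and
  \<open>(i, j)\<close> in the unprimed one.\<close>

lemma para_hermitian_outer_part:
  assumes R: "R \<in> carrier_mat m m" and para: "para_hermitian R"
    and Rin: "Rin \<in> carrier_mat m m" and Rout: "Rout \<in> carrier_mat m m"
    and RS: "RS \<in> carrier_mat m m" and R0: "R0 \<in> carrier_mat m m"
    and sum: "R = Rin + Rout + RS + rat_mat (const_mat R0)"
    and Rin0: "strictly_proper Rin" "\<And>z. mat_pole Rin z \<Longrightarrow> norm z < 1"
    and Rout0: "map_mat (\<lambda>r. rat_eval r 0) Rout = 0\<^sub>m m m" "\<And>z. mat_pole Rout z \<Longrightarrow> norm z > 1"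
    and RS0: "strictly_proper RS" "\<And>z. mat_pole RS z \<Longrightarrow> norm z = 1"
  shows "Rout = transpose_mat (map_mat (\<lambda>r. rat_recip (rat_cnj r)) Rin)"
proof (rule eq_matI)
  fix i j assume "i < dim_row (transpose_mat (map_mat (\<lambda>r. rat_recip (rat_cnj r)) Rin))"
    "j < dim_col (transpose_mat (map_mat (\<lambda>r. rat_recip (rat_cnj r)) Rin))"
  then have ij: "i < m" "j < m" using Rin by auto
  have pole: "rat_pole (M $$ (i, j)) z \<Longrightarrow> mat_pole M z" if "M \<in> carrier_mat m m" "i < m" "j < m" for M i j z
    using that by (auto simp: mat_pole_def)
  have proper: "proper0 (M $$ (i, j))" if "M \<in> carrier_mat m m" "strictly_proper M" "i < m" "j < m" for M i j
    using that by (intro proper0_if_tendsto_0) (auto simp: strictly_proper_def)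
  have entry: "R $$ (i, j) = Rin $$ (i, j) + Rout $$ (i, j) + RS $$ (i, j) + to_fract [:R0 $$ (i, j):]"
    if "i < m" "j < m" for i j
    unfolding sum using that Rin Rout RS R0 by simp
  have "rat_mat_star R $$ (i, j) = rat_mat_recip R $$ (i, j)" using para by (simp add: para_hermitian_def)
  then have "rat_cnj (R $$ (j, i)) = rat_recip (R $$ (i, j))"
    using ij R by (simp add: rat_mat_star_def rat_mat_recip_def)
  then have "Rout $$ (i, j) = rat_recip (rat_cnj (Rin $$ (j, i)))"
    unfolding entry[OF ij] entry[OF ij(2,1)]
  proof (rule para_hermitian_inner_outer)
    have "map_mat (\<lambda>r. rat_eval r 0) Rout $$ (i, j) = 0" using Rout0(1) ij by simp
    then show "rat_eval (Rout $$ (i, j)) 0 = 0" using ij Rout by simp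
  qed (use ij Rin Rout RS proper pole Rin0 Rout0(2) RS0 in auto)
  then show "Rout $$ (i, j) = transpose_mat (map_mat (\<lambda>r. rat_recip (rat_cnj r)) Rin) $$ (i, j)"
    using ij Rin by simp
qed (use Rin Rout in auto)

theorem theorem5p3:
  fixes R Rin Rout RS Rp :: "complex poly fract mat"
    and R0 A1 A0 B C :: "complex mat"
    and Ap Bp Cp Dp :: "complex poly mat"
    and m n p :: nat
  assumes "R \<in> carrier_mat m m" and "para_hermitian R"
    and "Rin \<in> carrier_mat m m" and "Rout \<in> carrier_mat m m"
    and "RS \<in> carrier_mat m m" and "R0 \<in> carrier_mat m m"
    and "R = Rin + Rout + RS + rat_mat (const_mat R0)"
    and "strictly_proper Rin" and "\<And>z. mat_pole Rin z \<Longrightarrow> norm z < 1"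
    and "map_mat (\<lambda>r. rat_eval r 0) Rout = 0\<^sub>m m m" and "\<And>z. mat_pole Rout z \<Longrightarrow> norm z > 1"
    and "strictly_proper RS" and "\<And>z. mat_pole RS z \<Longrightarrow> norm z = 1"
    and "Rp = RS + rat_mat (const_mat R0)"
    and "minimal_gss_realization n A1 A0 B C Rin" and "invertible_mat A1"
    and "Ap \<in> carrier_mat p p" and "Bp \<in> carrier_mat p m"
    and "Cp \<in> carrier_mat m p" and "Dp \<in> carrier_mat m m"
    and "strongly_minimal_linearization p (four_block_mat (- Ap) Bp Cp Dp) (to_fract (1 + Z) \<cdot>\<^sub>m Rp)"
    and "star_palindromic (four_block_mat (- Ap) Bp Cp Dp)"
  defines "L \<equiv>
    four_block_mat
      (four_block_mat
        (four_block_mat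
          (0\<^sub>m n n)                                                      (const_mat A0 - Z \<cdot>\<^sub>m const_mat A1)
          (Z \<cdot>\<^sub>m const_mat (mat_adjoint A0) - const_mat (mat_adjoint A1)) (0\<^sub>m n n))
        (0\<^sub>m (n + n) p)
        (0\<^sub>m p (n + n))
        (- Ap))
      (const_mat C @\<^sub>r (1 + Z) \<cdot>\<^sub>m const_mat (mat_adjoint B) @\<^sub>r Bp)
      (Z \<cdot>\<^sub>m const_mat (mat_adjoint C) @\<^sub>c (1 + Z) \<cdot>\<^sub>m const_mat B @\<^sub>c Cp)
      Dp"
  shows "strongly_minimal_linearization (n + n + p) L (to_fract (1 + Z) \<cdot>\<^sub>m R) \<and> star_palindromic L"
proof -
  note R = assms(1) and Rin = assms(3) and Rout = assms(4) and RS = assms(5) and R0 = assms(6)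
  note Ap = assms(17) and Bp = assms(18) and Cp = assms(19) and Dp = assms(20)
  have A1: "A1 \<in> carrier_mat n n" and A0: "A0 \<in> carrier_mat n n"
    and B: "B \<in> carrier_mat m n" and C: "C \<in> carrier_mat n m"
    using assms(15) Rin by (auto simp: minimal_gss_realization_def)
  define M where "M = Z \<cdot>\<^sub>m const_mat A1 - const_mat A0"
  define P where "P = const_mat A0 - Z \<cdot>\<^sub>m const_mat A1"
  define Q where "Q = Z \<cdot>\<^sub>m const_mat (mat_adjoint A0) - const_mat (mat_adjoint A1)"
  define E where "E = Z \<cdot>\<^sub>m const_mat (mat_adjoint C)"
  define F where "F = (1 + Z) \<cdot>\<^sub>m const_mat B"
  define F' where "F' = (1 + Z) \<cdot>\<^sub>m const_mat (mat_adjoint B)"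
  \<comment> \<open>This is the top-left block of \<open>L\<close>, that is, \<open>-A(z)\<close>;
    the state pencil itself therefore contains \<open>M\<close>, \<open>- Q\<close> and
    \<open>Ap\<close>.\<close>
  define X where "X = four_block_mat (four_block_mat (0\<^sub>m n n) P Q (0\<^sub>m n n)) (0\<^sub>m (n + n) p) (0\<^sub>m p (n + n)) (- Ap)"
  define Bc where "Bc = const_mat C @\<^sub>r F' @\<^sub>r Bp"
  define Cc where "Cc = E @\<^sub>c F @\<^sub>c Cp"
  have M: "M \<in> carrier_mat n n" and P: "P \<in> carrier_mat n n" and Q: "Q \<in> carrier_mat n n"
    and E: "E \<in> carrier_mat m n" and F: "F \<in> carrier_mat m n" and F': "F' \<in> carrier_mat n m"
    and cC: "const_mat C \<in> carrier_mat n m"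
    using A1 A0 B C by (auto simp: M_def P_def Q_def E_def F_def F'_def)
  have PQ: "four_block_mat (0\<^sub>m n n) P Q (0\<^sub>m n n) \<in> carrier_mat (n + n) (n + n)" using P Q by auto
  have X: "X \<in> carrier_mat (n + n + p) (n + n + p)" unfolding X_def using PQ Ap by auto
  have Bc: "Bc \<in> carrier_mat (n + n + p) m"
    using carrier_append_rows[OF cC carrier_append_rows[OF F' Bp]] by (simp add: Bc_def add.assoc)
  have Cc: "Cc \<in> carrier_mat m (n + n + p)"
    using carrier_append_cols[OF E carrier_append_cols[OF F Cp]] by (simp add: Cc_def add.assoc)
  have L_eq: "L = four_block_mat X Bc Cc Dp"
    unfolding L_def X_def Bc_def Cc_def P_def Q_def E_def F_def F'_def ..
  have L: "L \<in> carrier_mat (n + n + p + m) (n + n + p + m)" unfolding L_eq using X Dp by auto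
  note blkL = blk_four_block_mat[OF X Bc Cc Dp, folded L_eq]

  have eval_M: "eval_mat M z = z \<cdot>\<^sub>m A1 - A0" for z
    using A1 A0 unfolding M_def eval_mat_def by (intro eq_matI) auto
  have eval_P: "eval_mat P z = - eval_mat M z" for z
    using A1 A0 unfolding P_def M_def eval_mat_def by (intro eq_matI) auto
  have eval_Q: "eval_mat Q z = z \<cdot>\<^sub>m mat_adjoint A0 - mat_adjoint A1" for z
    using A1 A0 unfolding Q_def eval_mat_def by (intro eq_matI) auto
  have eval_E: "eval_mat E z = z \<cdot>\<^sub>m mat_adjoint C" for z
    unfolding E_def eval_mat_def by (intro eq_matI) auto
  have eval_F: "eval_mat F z = (1 + z) \<cdot>\<^sub>m B" for z
    unfolding F_def eval_mat_def by (intro eq_matI) (auto simp: algebra_simps)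
  have eval_F': "eval_mat F' z = (1 + z) \<cdot>\<^sub>m mat_adjoint B" for z
    unfolding F'_def eval_mat_def by (intro eq_matI) (auto simp: algebra_simps)
  \<comment> \<open>The reflection \<open>1 / cnj z\<close> in the unit circle turns facts about
    \<open>M\<close> on and outside the circle into facts about \<open>Q\<close> on and inside
    it.\<close>
  have Q_reflect: "eval_mat Q z = (- z) \<cdot>\<^sub>m mat_adjoint (eval_mat M (1 / cnj z))" if "z \<noteq> 0" for z
    using A1 A0 that unfolding eval_Q eval_M by (intro eq_matI) (auto simp: field_simps)

  \<comment> \<open>The inner system and its reflection\<close>
  let ?Lin = "four_block_mat (- M) (const_mat C) (const_mat B) (0\<^sub>m m m)"
  have Lin: "?Lin \<in> carrier_mat (n + m) (n + m)" using M by auto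
  have blkLin: "blk_A n ?Lin = M" "blk_B n ?Lin = const_mat C" "blk_C n ?Lin = const_mat B"
    using blk_four_block_mat[of "- M" n "const_mat C" m "const_mat B" m "0\<^sub>m m m"] M B C by (auto simp: uminus_uminus_mat)
  have "minimal_lsm n ?Lin"
    using assms(15) Rin by (simp add: minimal_gss_realization_def M_def)
  then have lsm_in: "linear_system_matrix n ?Lin"
    and row_in: "inj_pair (transpose_mat (eval_mat (- M) z)) (transpose_mat C)"
    and col_in: "inj_pair (eval_mat (- M) z) B" for z
    using minimal_lsm_iff[OF Lin] by (auto simp: blkLin)
  have Rin_eq: "Rin = rat_mat (const_mat B) * rat_mat_inv (rat_mat M) * rat_mat (const_mat C)"
    using assms(15) by (simp add: minimal_gss_realization_def M_def)
  have "det M \<noteq> 0" using lsm_in by (simp add: linear_system_matrix_def blkLin)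
  then have det_rM: "det (rat_mat M) \<noteq> 0" by simp
  have rM: "rat_mat M \<in> carrier_mat n n" using M by simp
  note Mi = rat_mat_inv[OF rM det_rM]
  have det_M: "det (eval_mat M z) \<noteq> 0" if "norm z \<ge> 1" for z
  proof (rule regular_transfer_function_imp_nonsingular[OF M _ _ Mi])
    show "\<not> mat_pole (rat_mat (const_mat B) * rat_mat_inv (rat_mat M) * rat_mat (const_mat C)) z"
      using assms(9) that unfolding Rin_eq[symmetric] by force
  qed (use B C row_in col_in in auto)
  have det_P: "det (eval_mat P z) \<noteq> 0" if "norm z \<ge> 1" for z
    using det_M[OF that] det_uminus_eq_0_iff[of "eval_mat M z" n] M by (simp add: eval_P)
  have det_Q: "det (eval_mat Q z) \<noteq> 0" if "norm z \<le> 1" for z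
  proof (cases "z = 0")
    \<comment> \<open>The reflection of \<open>0\<close> is infinity, so this point is settled by
      the invertibility of \<open>A1\<close> instead.\<close>
    case True
    have "eval_mat Q 0 = (- 1) \<cdot>\<^sub>m mat_adjoint A1"
      unfolding eval_Q using A1 A0 by (intro eq_matI) auto
    then show ?thesis
      using True invertible_mat_imp_det_nonzero[OF A1 assms(16)] by (simp add: det_mat_adjoint[OF A1])
  next
    case False
    have "norm (1 / cnj z) \<ge> 1" using that False by (simp add: norm_divide)
    then show ?thesis
      using det_M False det_mat_adjoint[of "eval_mat M (1 / cnj z)" n] M by (simp add: Q_reflect)
  qed

  \<comment> \<open>The system with poles on the unit circle\<close>
  let ?Lp = "four_block_mat (- Ap) Bp Cp Dp"
  have Lp: "?Lp \<in> carrier_mat (p + m) (p + m)" using Ap Dp by auto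
  have mAp: "- Ap \<in> carrier_mat p p" using Ap by simp
  have blkLp: "blk_A p ?Lp = Ap" "blk_B p ?Lp = Bp" "blk_C p ?Lp = Cp" "blk_D p ?Lp = Dp"
    using blk_four_block_mat[OF mAp Bp Cp Dp] by auto
  have "minimal_lsm p ?Lp" and transfer_p: "transfer_function p ?Lp = to_fract (1 + Z) \<cdot>\<^sub>m Rp"
    using assms(21) by (auto simp: strongly_minimal_linearization_def strongly_minimal_def)
  then have lsm_p: "linear_system_matrix p ?Lp"
    and row_p: "inj_pair (transpose_mat (eval_mat (- Ap) z)) (transpose_mat (eval_mat Bp z))"
    and col_p: "inj_pair (eval_mat (- Ap) z) (eval_mat Cp z)" for z
    using minimal_lsm_iff[OF Lp] by (auto simp: blkLp)
  have "det Ap \<noteq> 0" using lsm_p by (simp add: linear_system_matrix_def blkLp)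
  then have det_rAp: "det (rat_mat Ap) \<noteq> 0" by simp
  have rAp: "rat_mat Ap \<in> carrier_mat p p" using Ap by simp
  note Si = rat_mat_inv[OF rAp det_rAp]
  define Hp where "Hp = rat_mat Cp * rat_mat_inv (rat_mat Ap) * rat_mat Bp"
  have Hp: "Hp \<in> carrier_mat m m" using Bp Cp Si by (auto simp: Hp_def)
  have Rp: "Rp \<in> carrier_mat m m" using RS R0 assms(14) by simp
  have transfer_p': "rat_mat Dp + Hp = to_fract (1 + Z) \<cdot>\<^sub>m Rp"
    using transfer_p by (simp add: transfer_function_def blkLp Hp_def)
  \<comment> \<open>\<open>Hp\<close> differs from \<open>(1 + z) Rp\<close> by the polynomial
    matrix \<open>Dp\<close>, and multiplication by \<open>1 + z\<close> creates no finite pole, so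
    off the unit circle \<open>Hp\<close> has no poles.\<close>
  have det_Ap: "det (eval_mat (- Ap) z) \<noteq> 0" if "norm z \<noteq> 1" for z
  proof -
    have "\<not> mat_pole Rp z"
      unfolding assms(14) using assms(13) that RS R0 by (intro not_mat_pole_add[of _ _ _ m m]) auto
    then have "\<not> mat_pole (to_fract (1 + Z) \<cdot>\<^sub>m Rp - rat_mat Dp) z"
      using Rp Dp by (intro not_mat_pole_diff[of _ _ _ m m] not_mat_pole_smult not_rat_pole_to_fract) auto
    also have "to_fract (1 + Z) \<cdot>\<^sub>m Rp - rat_mat Dp = Hp"
      unfolding transfer_p'[symmetric] using Hp Dp by (intro eq_matI) auto
    finally have "\<not> mat_pole Hp z" .
    then have "det (eval_mat Ap z) \<noteq> 0"
      unfolding Hp_def by (intro regular_transfer_function_imp_nonsingular[OF Ap Bp Cp Si row_p col_p])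
    then show ?thesis using Ap det_uminus_eq_0_iff[of "eval_mat Ap z" p] by (simp add: eval_mat_uminus)
  qed

  have eval_X: "eval_mat X z = four_block_mat (four_block_mat (0\<^sub>m n n) (eval_mat P z) (eval_mat Q z) (0\<^sub>m n n))
      (0\<^sub>m (n + n) p) (0\<^sub>m p (n + n)) (eval_mat (- Ap) z)" for z
    unfolding X_def using P Q PQ mAp
    by (simp add: eval_lead_four_block_mat[of _ "n + n" "n + n" _ p _ p] eval_lead_four_block_mat[of _ n n _ n _ n])
  have eval_Cc: "eval_mat Cc z = eval_mat E z @\<^sub>c eval_mat F z @\<^sub>c eval_mat Cp z" for z
    unfolding Cc_def using E F Cp
    by (simp add: eval_lead_append_cols[of _ m n _ "n + p"] eval_lead_append_cols[of _ m n _ p])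
  have eval_Bc: "eval_mat Bc z = C @\<^sub>r eval_mat F' z @\<^sub>r eval_mat Bp z" for z
    unfolding Bc_def using C F' Bp
    by (simp add: eval_lead_append_rows[of _ n m _ "n + p"] eval_lead_append_rows[of _ n m _ p])

  \<comment> \<open>The rank conditions at every point\<close>
  have col: "inj_pair (eval_mat X z) (eval_mat Cc z)" for z
    unfolding eval_X eval_Cc
  proof (rule inj_pair_block)
    consider "norm z < 1" | "norm z = 1" | "norm z > 1" by linarith
    then show "det (eval_mat Q z) \<noteq> 0 \<and> det (eval_mat (- Ap) z) \<noteq> 0 \<and> inj_pair (eval_mat P z) (eval_mat F z) \<or>
      det (eval_mat P z) \<noteq> 0 \<and> det (eval_mat (- Ap) z) \<noteq> 0 \<and> inj_pair (eval_mat Q z) (eval_mat E z) \<or>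
      det (eval_mat P z) \<noteq> 0 \<and> det (eval_mat Q z) \<noteq> 0 \<and> inj_pair (eval_mat (- Ap) z) (eval_mat Cp z)"
    proof cases
      \<comment> \<open>Only \<open>P\<close> can be singular here. In the open disk
        \<open>1 + z\<close> is nonzero, so the column condition of the inner system survives the
        scaling of \<open>B\<close>.\<close>
      case 1
      then have "1 + z \<noteq> 0" by (auto simp: add_eq_0_iff)
      then have "inj_pair (1 \<cdot>\<^sub>m eval_mat (- M) z) ((1 + z) \<cdot>\<^sub>m B)"
        using M B by (intro inj_pair_smult[OF col_in]) auto
      moreover have "1 \<cdot>\<^sub>m eval_mat (- M) z = eval_mat P z"
        unfolding eval_P eval_mat_uminus by (intro eq_matI) auto
      ultimately have "inj_pair (eval_mat P z) (eval_mat F z)" unfolding eval_F by simp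
      then show ?thesis using 1 det_Q[of z] det_Ap[of z] by simp
    next
      \<comment> \<open>On the circle \<open>P\<close> and \<open>Q\<close> are both nonsingular, so
        it does not matter that \<open>F\<close> vanishes at \<open>-1\<close>.\<close>
      case 2
      then show ?thesis using det_P[of z] det_Q[of z] col_p by simp
    next
      \<comment> \<open>The adjoint of the row condition of the inner system at
        \<open>1 / cnj z\<close> is the column condition for \<open>Q\<close> and \<open>E\<close>,
        up to the nonzero factor \<open>z\<close>.\<close>
      case 3
      then have "z \<noteq> 0" by auto
      have "inj_pair (z \<cdot>\<^sub>m mat_adjoint (eval_mat (- M) (1 / cnj z))) (z \<cdot>\<^sub>m mat_adjoint C)"
        using M C \<open>z \<noteq> 0\<close> by (intro inj_pair_smult[OF inj_pair_adjoint[OF _ _ row_in]]) auto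
      moreover have "z \<cdot>\<^sub>m mat_adjoint (eval_mat (- M) (1 / cnj z)) = eval_mat Q z"
        unfolding Q_reflect[OF \<open>z \<noteq> 0\<close>] eval_mat_uminus by (intro eq_matI) auto
      ultimately have "inj_pair (eval_mat Q z) (eval_mat E z)" unfolding eval_E by simp
      then show ?thesis using 3 det_P[of z] det_Ap[of z] by simp
    qed
  qed (use P Q E F mAp Cp in auto)

  have row: "inj_pair (transpose_mat (eval_mat X z)) (transpose_mat (eval_mat Bc z))" for z
  proof -
    let ?P = "eval_mat P z" and ?Q = "eval_mat Q z" and ?S = "eval_mat (- Ap) z"
    let ?F = "eval_mat F' z" and ?B = "eval_mat Bp z"
    have Pz: "?P \<in> carrier_mat n n" and Qz: "?Q \<in> carrier_mat n n" and Sz: "?S \<in> carrier_mat p p"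
      and Fz: "?F \<in> carrier_mat n m" and Bz: "?B \<in> carrier_mat p m" using P Q mAp F' Bp by auto
    \<comment> \<open>Transposition exchanges the antidiagonal blocks, so now \<open>?Q\<close> is
      paired with \<open>F'\<close> and \<open>?P\<close> with \<open>C\<close>.\<close>
    have tX: "transpose_mat (eval_mat X z) = four_block_mat (four_block_mat (0\<^sub>m n n) (transpose_mat ?Q) (transpose_mat ?P) (0\<^sub>m n n))
      (0\<^sub>m (n + n) p) (0\<^sub>m p (n + n)) (transpose_mat ?S)"
      unfolding eval_X using Pz Qz Sz
      by (subst transpose_four_block_mat[of _ "n + n" "n + n" _ p _ p])
        (auto simp: transpose_four_block_mat[of _ n n _ n _ n])
    have tB: "transpose_mat (eval_mat Bc z) = transpose_mat C @\<^sub>c transpose_mat ?F @\<^sub>c transpose_mat ?B"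
      unfolding eval_Bc using C Fz Bz
      by (simp add: transpose_append_rows[of _ n m _ "n + p"] transpose_append_rows[of _ n m _ p])
    show ?thesis unfolding tX tB
    proof (rule inj_pair_block)
      have dets: "det (transpose_mat ?P) = det ?P" "det (transpose_mat ?Q) = det ?Q" "det (transpose_mat ?S) = det ?S"
        using Pz Qz Sz by (simp_all add: det_transpose)
      consider "norm z < 1" | "norm z = 1" | "norm z > 1" by linarith
      then have "det ?P \<noteq> 0 \<and> det ?S \<noteq> 0 \<and> inj_pair (transpose_mat ?Q) (transpose_mat ?F) \<or>
        det ?Q \<noteq> 0 \<and> det ?S \<noteq> 0 \<and> inj_pair (transpose_mat ?P) (transpose_mat C) \<or>
        det ?Q \<noteq> 0 \<and> det ?P \<noteq> 0 \<and> inj_pair (transpose_mat ?S) (transpose_mat ?B)"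
      proof cases
        case 1
        have "inj_pair (transpose_mat ?P) (transpose_mat C)"
          using row_in[of z] unfolding eval_P eval_mat_uminus .
        then show ?thesis
          using 1 det_Q[of z] det_Ap[of z] by simp
      next
        case 2
        then show ?thesis
          using det_P[of z] det_Q[of z] row_p by simp
      next
        \<comment> \<open>Here the column condition of the inner system at the reflected point is
          transported; the adjoint exchanges the roles of rows and columns.\<close>
        case 3
        then have z: "z \<noteq> 0" "1 + z \<noteq> 0" by (auto simp: add_eq_0_iff)
        have "inj_pair (z \<cdot>\<^sub>m transpose_mat (mat_adjoint (eval_mat (- M) (1 / cnj z)))) ((1 + z) \<cdot>\<^sub>m transpose_mat (mat_adjoint B))"
          using M B z by (intro inj_pair_smult[OF inj_pair_transpose_adjoint[OF _ _ col_in]]) auto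
        moreover have "z \<cdot>\<^sub>m transpose_mat (mat_adjoint (eval_mat (- M) (1 / cnj z))) = transpose_mat ?Q"
          unfolding Q_reflect[OF z(1)] eval_mat_uminus by (intro eq_matI) auto
        moreover have "(1 + z) \<cdot>\<^sub>m transpose_mat (mat_adjoint B) = transpose_mat ?F"
          unfolding eval_F' by (intro eq_matI) auto
        ultimately have "inj_pair (transpose_mat ?Q) (transpose_mat ?F)" by simp
        then show ?thesis
          using 3 det_P[of z] det_Ap[of z] by simp
      qed
      then show "det (transpose_mat ?P) \<noteq> 0 \<and> det (transpose_mat ?S) \<noteq> 0 \<and> inj_pair (transpose_mat ?Q) (transpose_mat ?F) \<or>
        det (transpose_mat ?Q) \<noteq> 0 \<and> det (transpose_mat ?S) \<noteq> 0 \<and> inj_pair (transpose_mat ?P) (transpose_mat C) \<or>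
        det (transpose_mat ?Q) \<noteq> 0 \<and> det (transpose_mat ?P) \<noteq> 0 \<and> inj_pair (transpose_mat ?S) (transpose_mat ?B)"
        by (simp only: dets)
    qed (use Pz Qz Sz C Fz Bz in auto)
  qed

  \<comment> \<open>Palindromicity of the combined pencil\<close>
  have pal: "star_palindromic L"
  proof -
    have deg: "degree (Z * [:a:]) \<le> 1" "degree ((1 + Z) * [:a:]) \<le> 1" for a :: complex
      by (auto simp: one_pCons)
    have pencil_p: "pencil (- Ap)" "pencil Bp" "pencil Cp" "pencil Dp"
      and pal_p: "eval_mat ?Lp 0 = mat_adjoint (lead_mat ?Lp)"
      using assms(22) unfolding star_palindromic_iff_adjoint[OF Lp] pencil_four_block_mat[OF mAp Bp Cp Dp] by auto
    have pencil_in: "pencil P" "pencil Q" "pencil (const_mat C)" "pencil F'" "pencil E" "pencil F"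
      using A1 A0 B C unfolding P_def Q_def F'_def E_def F_def
      by (auto simp: pencil_iff one_pCons intro!: degree_diff_le)
    have "pencil L" unfolding L_eq pencil_four_block_mat[OF X Bc Cc Dp]
      unfolding X_def Bc_def Cc_def
      using pencil_p pencil_in P Q PQ mAp E F Cp cC F' Bp
      by (simp add: pencil_four_block_mat[of _ "n + n" "n + n" _ p _ p] pencil_four_block_mat[of _ n n _ n _ n]
          pencil_append_cols[of _ m n _ "n + p"] pencil_append_cols[of _ m n _ p]
          pencil_append_rows[of _ n m _ "n + p"] pencil_append_rows[of _ n m _ p])
    moreover have "eval_mat L 0 = mat_adjoint (lead_mat L)"
    proof -
      have "four_block_mat (eval_mat (- Ap) 0) (eval_mat Bp 0) (eval_mat Cp 0) (eval_mat Dp 0) =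
        four_block_mat (mat_adjoint (lead_mat (- Ap))) (mat_adjoint (lead_mat Cp)) (mat_adjoint (lead_mat Bp)) (mat_adjoint (lead_mat Dp))"
        using pal_p mAp Bp Cp Dp
        by (simp add: eval_lead_four_block_mat[OF mAp Bp Cp Dp] mat_adjoint_four_block_mat[of _ p p _ m _ m])
      from four_block_mat_inject[OF _ _ _ _ _ _ _ _ this, of p p m m]
      have pal_blocks: "eval_mat (- Ap) 0 = mat_adjoint (lead_mat (- Ap))" "eval_mat Bp 0 = mat_adjoint (lead_mat Cp)"
        "eval_mat Cp 0 = mat_adjoint (lead_mat Bp)" "eval_mat Dp 0 = mat_adjoint (lead_mat Dp)"
        using mAp Bp Cp Dp by auto
      \<comment> \<open>\<open>P\<close> is paired with \<open>Q\<close>, \<open>C\<close> with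
        \<open>E\<close> and \<open>F'\<close> with \<open>F\<close>. The factor
        \<open>1 + z\<close> is its own reversal, whereas the reversal of the constant
        \<open>1\<close> is \<open>z\<close>.\<close>
      have in_blocks: "eval_mat P 0 = mat_adjoint (lead_mat Q)" "eval_mat Q 0 = mat_adjoint (lead_mat P)"
        "C = mat_adjoint (lead_mat E)" "eval_mat F' 0 = mat_adjoint (lead_mat F)"
        "eval_mat E 0 = mat_adjoint (lead_mat (const_mat C))" "eval_mat F 0 = mat_adjoint (lead_mat F')"
        using A1 A0 B C unfolding P_def Q_def E_def F_def F'_def eval_mat_def lead_mat_def
        by (auto intro!: eq_matI simp: one_pCons)
      have lX: "lead_mat X = four_block_mat (four_block_mat (0\<^sub>m n n) (lead_mat P) (lead_mat Q) (0\<^sub>m n n))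
          (0\<^sub>m (n + n) p) (0\<^sub>m p (n + n)) (lead_mat (- Ap))"
        unfolding X_def using P Q PQ mAp
        by (simp add: eval_lead_four_block_mat[of _ "n + n" "n + n" _ p _ p] eval_lead_four_block_mat[of _ n n _ n _ n])
      have X0: "eval_mat X 0 = mat_adjoint (lead_mat X)"
        unfolding eval_X lX using P Q mAp
        by (subst mat_adjoint_four_block_mat[of _ "n + n" "n + n" _ p _ p])
          (auto simp: mat_adjoint_four_block_mat[of _ n n _ n _ n] in_blocks pal_blocks)
      have lC: "lead_mat Cc = lead_mat E @\<^sub>c lead_mat F @\<^sub>c lead_mat Cp"
        unfolding Cc_def using E F Cp
        by (simp add: eval_lead_append_cols[of _ m n _ "n + p"] eval_lead_append_cols[of _ m n _ p])
      have lB: "lead_mat Bc = lead_mat (const_mat C) @\<^sub>r lead_mat F' @\<^sub>r lead_mat Bp"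
        unfolding Bc_def using cC F' Bp
        by (simp add: eval_lead_append_rows[of _ n m _ "n + p"] eval_lead_append_rows[of _ n m _ p])
      have B0: "eval_mat Bc 0 = mat_adjoint (lead_mat Cc)"
        unfolding eval_Bc lC using E F Cp
        by (subst mat_adjoint_append_cols[of _ m n _ "n + p"])
          (auto simp: mat_adjoint_append_cols[of _ m n _ p] pal_blocks in_blocks(4) simp flip: in_blocks(3))
      have C0: "eval_mat Cc 0 = mat_adjoint (lead_mat Bc)"
        unfolding eval_Cc lB using cC F' Bp
        by (subst mat_adjoint_append_rows[of _ n m _ "n + p"])
          (auto simp: mat_adjoint_append_rows[of _ n m _ p] pal_blocks in_blocks(5,6))
      have lc: "lead_mat X \<in> carrier_mat (n + n + p) (n + n + p)" "lead_mat Bc \<in> carrier_mat (n + n + p) m"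
        "lead_mat Cc \<in> carrier_mat m (n + n + p)" "lead_mat Dp \<in> carrier_mat m m" using X Bc Cc Dp by auto
      show ?thesis
        unfolding L_eq eval_lead_four_block_mat[OF X Bc Cc Dp] mat_adjoint_four_block_mat[OF lc]
        by (simp only: X0 B0 C0 pal_blocks)
    qed
    ultimately show ?thesis unfolding star_palindromic_iff_adjoint[OF L] by blast
  qed

  \<comment> \<open>The inverse of the state pencil and strong minimality\<close>
  define K where "K = four_block_mat (four_block_mat (0\<^sub>m n n) (rat_mat_inv (rat_mat (- Q))) (rat_mat_inv (rat_mat M)) (0\<^sub>m n n))
      (0\<^sub>m (n + n) p) (0\<^sub>m p (n + n)) (rat_mat_inv (rat_mat Ap))"
  have rQ: "rat_mat (- Q) \<in> carrier_mat n n" using Q by simp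
  \<comment> \<open>Nonsingularity at the single point \<open>0\<close> shows that the determinant
    is not the zero polynomial, so \<open>- Q\<close> is invertible over the rational
    functions.\<close>
  have "poly (det Q) 0 \<noteq> 0" using det_Q[of 0] by (simp add: det_eval_mat)
  then have "det Q \<noteq> 0" by auto
  then have det_rQ: "det (rat_mat (- Q)) \<noteq> 0" using det_uminus_eq_0_iff[OF Q] by simp
  note Qi = rat_mat_inv[OF rQ det_rQ]
  have K: "K \<in> carrier_mat (n + n + p) (n + n + p)"
    unfolding K_def using Mi(1) Qi(1) Si(1) by (intro four_block_carrier_mat) auto
  have "P = - M" unfolding P_def M_def using A1 A0 by (intro eq_matI) auto
  have mX: "blk_A (n + n + p) L = four_block_mat (four_block_mat (0\<^sub>m n n) M (- Q) (0\<^sub>m n n)) (0\<^sub>m (n + n) p) (0\<^sub>m p (n + n)) Ap"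
    unfolding blkL X_def \<open>P = - M\<close> using M Q Ap by (intro eq_matI) auto
  have rX: "rat_mat (blk_A (n + n + p) L) =
      four_block_mat (four_block_mat (0\<^sub>m n n) (rat_mat M) (rat_mat (- Q)) (0\<^sub>m n n)) (0\<^sub>m (n + n) p) (0\<^sub>m p (n + n)) (rat_mat Ap)"
    unfolding mX using M Q Ap by (intro eq_matI) auto
  have AK: "rat_mat (blk_A (n + n + p) L) * K = 1\<^sub>m (n + n + p)"
    unfolding rX K_def by (rule block_inverse[OF rM rQ rAp Mi(1) Qi(1) Si(1) Mi(2) Qi(2) Si(2)])
  have rA: "rat_mat (blk_A (n + n + p) L) \<in> carrier_mat (n + n + p) (n + n + p)" unfolding blkL using X by simp
  have inv_K: "rat_mat_inv (rat_mat (blk_A (n + n + p) L)) = K" by (rule rat_mat_inv_unique[OF rA K AK])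
  have "det (blk_A (n + n + p) L) \<noteq> 0" using det_nonzero_if_right_inverse[OF rA K AK] by auto
  then have lsm: "linear_system_matrix (n + n + p) L"
    using L pal by (simp add: linear_system_matrix_def star_palindromic_def)
  have mmX: "- (- X) = X" by (intro eq_matI) auto
  have min: "minimal_lsm (n + n + p) L"
    unfolding minimal_lsm_iff[OF L] blkL mmX using lsm row col by blast
  have strong: "strongly_minimal (n + n + p) L"
    unfolding strongly_minimal_def using min star_palindromic_minimal_at_infinity[OF L pal min] by blast

  \<comment> \<open>The transfer function\<close>
  have Rout_eq: "Rout = to_fract Z \<cdot>\<^sub>m (rat_mat (const_mat (mat_adjoint C)) * rat_mat_inv (rat_mat (- Q)) * rat_mat (const_mat (mat_adjoint B)))"
  proof -
    have mQ: "- Q = const_mat (mat_adjoint A1) - Z \<cdot>\<^sub>m const_mat (mat_adjoint A0)"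
      unfolding Q_def using A1 A0 by (intro eq_matI) auto
    have "Rout = transpose_mat (map_mat (\<lambda>r. rat_recip (rat_cnj r)) Rin)"
      by (rule para_hermitian_outer_part[OF R assms(2) Rin Rout RS R0 assms(7-13)])
    also have "\<dots> = to_fract Z \<cdot>\<^sub>m (rat_mat (const_mat (mat_adjoint C)) * rat_mat_inv (rat_mat (- Q)) * rat_mat (const_mat (mat_adjoint B)))"
      unfolding mQ
      by (rule rat_mat_recip_cnj_realization[OF A1 A0 B C]) (use det_rM Rin_eq det_rQ mQ M_def in auto)
    finally show ?thesis .
  qed
  have "transfer_function (n + n + p) L = to_fract (1 + Z) \<cdot>\<^sub>m R"
  proof -
    let ?z = "to_fract (1 + Z)"
    have rC: "rat_mat Cc = rat_mat E @\<^sub>c rat_mat F @\<^sub>c rat_mat Cp"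
      unfolding Cc_def using E F Cp by (simp add: map_append_cols[of _ m n _ "n + p"] map_append_cols[of _ m n _ p])
    have rB: "rat_mat Bc = rat_mat (const_mat C) @\<^sub>r rat_mat F' @\<^sub>r rat_mat Bp"
      unfolding Bc_def using cC F' Bp by (simp add: map_append_rows[of _ n m _ "n + p"] map_append_rows[of _ n m _ p])
    \<comment> \<open>The summands become \<open>(1 + z) Rin\<close>, \<open>(1 + z) Rout\<close>
      and \<open>Hp\<close>. In the middle one the factor \<open>z\<close> of \<open>E\<close>
      belongs to the realization of \<open>Rout\<close>, while \<open>F'\<close> supplies
      \<open>1 + z\<close>.\<close>
    have "rat_mat Cc * K * rat_mat Bc = rat_mat F * rat_mat_inv (rat_mat M) * rat_mat (const_mat C) +
        rat_mat E * rat_mat_inv (rat_mat (- Q)) * rat_mat F' + rat_mat Cp * rat_mat_inv (rat_mat Ap) * rat_mat Bp"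
      unfolding rC rB K_def by (rule block_transfer) (use E F Cp Mi(1) Qi(1) Si(1) cC F' Bp in auto)
    also have "rat_mat F * rat_mat_inv (rat_mat M) * rat_mat (const_mat C) = ?z \<cdot>\<^sub>m Rin"
    proof -
      have "rat_mat F = ?z \<cdot>\<^sub>m rat_mat (const_mat B)"
        unfolding F_def by (intro eq_matI) (auto simp: to_fract_hom.hom_mult simp del: mult_pCons_right)
      moreover have rB: "rat_mat (const_mat B) \<in> carrier_mat m n" and rC: "rat_mat (const_mat C) \<in> carrier_mat n m"
        using B C by auto
      ultimately show ?thesis unfolding Rin_eq
        by (simp only: mult_smult_assoc_mat[OF rB Mi(1)] mult_smult_assoc_mat[OF mult_carrier_mat[OF rB Mi(1)] rC])
    qed
    also have "rat_mat E * rat_mat_inv (rat_mat (- Q)) * rat_mat F' = ?z \<cdot>\<^sub>m Rout"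
    proof -
      define U where "U = rat_mat (const_mat (mat_adjoint C))"
      define V where "V = rat_mat (const_mat (mat_adjoint B))"
      define W where "W = rat_mat_inv (rat_mat (- Q))"
      have U: "U \<in> carrier_mat m n" and V: "V \<in> carrier_mat n m" and W: "W \<in> carrier_mat n n"
        using B C Qi(1) by (auto simp: U_def V_def W_def)
      have "rat_mat F' = ?z \<cdot>\<^sub>m V"
        unfolding F'_def V_def by (intro eq_matI) (auto simp: to_fract_hom.hom_mult simp del: mult_pCons_right)
      moreover have "rat_mat E = to_fract Z \<cdot>\<^sub>m U"
        unfolding E_def U_def by (intro eq_matI) (auto simp: to_fract_hom.hom_mult simp del: mult_pCons_right mult_pCons_left)
      ultimately have "rat_mat E * W * rat_mat F' = to_fract Z \<cdot>\<^sub>m U * W * (?z \<cdot>\<^sub>m V)" by simp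
      also have "to_fract Z \<cdot>\<^sub>m U * W = to_fract Z \<cdot>\<^sub>m (U * W)" by (rule mult_smult_assoc_mat[OF U W])
      also have "to_fract Z \<cdot>\<^sub>m (U * W) * (?z \<cdot>\<^sub>m V) = ?z \<cdot>\<^sub>m (to_fract Z \<cdot>\<^sub>m (U * W) * V)"
        by (rule mult_smult_distrib[of _ m n _ m]) (use U V W in auto)
      also have "to_fract Z \<cdot>\<^sub>m (U * W) * V = to_fract Z \<cdot>\<^sub>m (U * W * V)"
        by (rule mult_smult_assoc_mat[of _ m n _ m]) (use U V W in auto)
      finally show ?thesis unfolding Rout_eq U_def V_def W_def .
    qed
    finally have "rat_mat Cc * K * rat_mat Bc = ?z \<cdot>\<^sub>m Rin + ?z \<cdot>\<^sub>m Rout + Hp" unfolding Hp_def .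
    then have "transfer_function (n + n + p) L = rat_mat Dp + (?z \<cdot>\<^sub>m Rin + ?z \<cdot>\<^sub>m Rout + Hp)"
      unfolding transfer_function_def inv_K blkL(2-4) by (simp only:)
    \<comment> \<open>Regrouping brings \<open>Dp\<close> next to \<open>Hp\<close>, since it is
      their sum that equals \<open>(1 + z) Rp\<close>.\<close>
    also have "\<dots> = (?z \<cdot>\<^sub>m Rin + ?z \<cdot>\<^sub>m Rout) + (rat_mat Dp + Hp)"
      using Rin Rout Hp Dp by (intro eq_matI) auto
    also have "\<dots> = ?z \<cdot>\<^sub>m R"
      unfolding transfer_p' assms(7) assms(14) using Rin Rout RS R0 by (intro eq_matI) (auto simp: distrib_left add.assoc)
    finally show ?thesis .
  qed
  then show ?thesis using strong pal by (simp add: strongly_minimal_linearization_def)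
qed

end
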